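(* Let $S$ be a positive integer and let $(e_n(s))_{n\ge1,\,1\le s\le S}$ be independent random variables, each uniformly distributed on $\{-1,+1\}$ (equivalently, $G_S(s)=(e_1(s),e_2(s),\dots)$, $1\le s\le S$, is drawn from the space of all such infinite families with the probability measure giving each prescribed assignment of $e_n(i)$, $1\le n\le N$, $1\le i\le S$, probability $2^{-NS}$, for every $N$). Let $G_{N,S}(s)=(e_1(s),\dots,e_N(s))$ for $1\le s\le S$. For every fixed integer $k\ge2$, \[ \frac{\Phi_k(G_{N,S})}{\sqrt{2N\log\binom{N}{k-1}}}\to 1\quad\text{almost surely as } N\to\infty. \]
   Context: For a map $G_{N,S}:\{1,\dots,S\}\to\{-1,+1\}^N$, $G_{N,S}(s)=(e_1(s),\dots,e_N(s))$, the cross-correlation measure of order $k$ is \[ \Phi_k(G_{N,S})=\max\left|\sum_{n=1}^M e_{n+d_1}(s_1)\cdots e_{n+d_k}(s_k)\right|, \] the maximum taken over all integers $M,d_1,\dots,d_k$ and $1\le s_1,\dots,s_k\le S$ with $0\le d_1\le\dots\le d_k<M+d_k\le N$ and $d_i\ne d_j$ whenever $s_i=s_j$. $\log$ is the natural logarithm. *)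

theory Defs
  imports "HOL-Probability.Probability"
begin

text \<open>A family e n s stands for e_n(s). Shifts d and signature indices s are
  functions on the index set {1..k}, normalised to 0 outside it.\<close>

definition corr_sum :: "(nat \<Rightarrow> nat \<Rightarrow> real) \<Rightarrow> nat \<Rightarrow> nat \<Rightarrow> (nat \<Rightarrow> nat) \<Rightarrow> (nat \<Rightarrow> nat) \<Rightarrow> real" where
  "corr_sum e k M d s = (\<Sum>n = 1..M. \<Prod>i = 1..k. e (n + d i) (s i))"

definition admissible :: "nat \<Rightarrow> nat \<Rightarrow> nat \<Rightarrow> nat \<Rightarrow> (nat \<Rightarrow> nat) \<Rightarrow> (nat \<Rightarrow> nat) \<Rightarrow> bool" where
  "admissible N S k M d s \<longleftrightarrow>
     (\<forall>i. i \<notin> {1..k} \<longrightarrow> d i = 0 \<and> s i = 0) \<and>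
     (\<forall>i\<in>{1..k}. 1 \<le> s i \<and> s i \<le> S) \<and>
     (\<forall>i\<in>{1..k}. \<forall>j\<in>{1..k}. i \<le> j \<longrightarrow> d i \<le> d j) \<and>
     d k < M + d k \<and> M + d k \<le> N \<and>
     (\<forall>i\<in>{1..k}. \<forall>j\<in>{1..k}. i \<noteq> j \<and> s i = s j \<longrightarrow> d i \<noteq> d j)"

definition cross_corr :: "nat \<Rightarrow> (nat \<Rightarrow> nat \<Rightarrow> real) \<Rightarrow> nat \<Rightarrow> nat \<Rightarrow> real" where
  "cross_corr k e N S =
     Max {\<bar>corr_sum e k M d s\<bar> | M d s. admissible N S k M d s}"

definition sign_space :: "nat \<Rightarrow> (nat \<times> nat \<Rightarrow> real) measure" where
  "sign_space S = PiM ({1..} \<times> {1..S}) (\<lambda>_. measure_pmf (pmf_of_set {-1, 1::real}))"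

end

theory Submission
  imports Defs "HOL-Real_Asymp.Real_Asymp"
begin

text \<open>For fixed lags, the correlation sums are the increments of a simple random walk, because the
  latest factor of each product is independent of all earlier products. Upper bound: only the
  k - 1 lag differences count, up to a constant factor; for each of them the largest increment of
  the walk has the same exponential tail as its endpoint (compare with the reflected walk), so a
  union bound over about $N^{k-1}$ patterns suffices. Lower bound: fix a short initial segment of
  length L and consider the $L \choose k-1$ walks whose lags are at most L. Two such walks are
  nearly independent at the exponential scale, since the conditional covariance of their steps is
  again the step of a random walk and hence sums to little. The second moment method
  therefore gives a probability that is at least a small negative power of N, and
  McDiarmid's inequality turns this into a bound whose failure probability is a negative power
  of N. Monotonicity in N and the Borel--Cantelli lemma along $N = j^m$ conclude.\<close>


section \<open>Averages over sign vectors\<close>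

text \<open>The constant comes from a balance: about N^(k-1) patterns against a tail exp(-l^2 / (2
  N)) gives l^2 = 2 (k-1) N log N, and log (N choose (k-1)) is asymptotic to (k-1) log N. For the
  lower bound L is N div q with a large fixed q: a constant factor lost in L does not affect log (L
  choose (k-1)) asymptotically, and the walks keep almost all of their N steps. The obstacle is that
  the second moment loses a factor exp(4 d T), T = n t^2, which is a small power of N, so by itself
  it never makes a large maximum likely. It suffices because a deviation by gamma times the scale
  has probability at most N^(-c), with c fixed by gamma, k and S, whereas d can afterwards be taken
  so small that the loss is at most about N^(c/2). Every event at stage N depends on N S signs only,
  so all estimates are finite averages; the product measure enters only through cylinder sets. Since
  the tails are mere powers of N, m must satisfy m c >= 2 for summability, and polynomial spacing
  still makes the scales at consecutive j^m asymptotically equal.\<close>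

definition sgns :: "'i set \<Rightarrow> ('i \<Rightarrow> real) set" where
  "sgns I = I \<rightarrow>\<^sub>E {-1, 1}"

text \<open>Expectation under independent fair signs; probabilities appear as averages of
  \<open>of_bool\<close>.\<close>

definition avg :: "'i set \<Rightarrow> (('i \<Rightarrow> real) \<Rightarrow> real) \<Rightarrow> real" where
  "avg I f = (\<Sum>e\<in>sgns I. f e) / 2 ^ card I"

definition flip :: "'i \<Rightarrow> ('i \<Rightarrow> real) \<Rightarrow> 'i \<Rightarrow> real" where
  "flip i e = e(i := - e i)"

lemma finite_sgns [simp]: "finite I \<Longrightarrow> finite (sgns I)"
  by (simp add: sgns_def finite_PiE)

lemma card_sgns: "finite I \<Longrightarrow> card (sgns I) = 2 ^ card I"
  by (simp add: sgns_def card_PiE numeral_2_eq_2)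

lemma sgns_cases: "e \<in> sgns I \<Longrightarrow> i \<in> I \<Longrightarrow> e i = 1 \<or> e i = -1"
  by (auto simp: sgns_def PiE_def Pi_def)

lemma flip_flip [simp]: "flip i (flip i e) = e"
  by (auto simp: flip_def)

lemma flip_in_sgns: "i \<in> I \<Longrightarrow> e \<in> sgns I \<Longrightarrow> flip i e \<in> sgns I"
  by (auto simp: flip_def sgns_def PiE_def Pi_def extensional_def)

lemma avg_const: "finite I \<Longrightarrow> avg I (\<lambda>_. c) = c"
  by (simp add: avg_def card_sgns)

lemma avg_mono:
  "(\<And>e. e \<in> sgns I \<Longrightarrow> f e \<le> g e) \<Longrightarrow> avg I f \<le> avg I g"
  unfolding avg_def by (intro divide_right_mono sum_mono) auto

lemma avg_cong:
  "(\<And>e. e \<in> sgns I \<Longrightarrow> f e = g e) \<Longrightarrow> avg I f = avg I g"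
  unfolding avg_def by (auto intro: sum.cong)

lemma avg_nonneg: "(\<And>e. e \<in> sgns I \<Longrightarrow> 0 \<le> f e) \<Longrightarrow> 0 \<le> avg I f"
  unfolding avg_def by (intro divide_nonneg_nonneg sum_nonneg) auto

lemma avg_add: "avg I (\<lambda>e. f e + g e) = avg I f + avg I g"
  by (simp add: avg_def sum.distrib add_divide_distrib)

lemma avg_cmult: "avg I (\<lambda>e. c * f e) = c * avg I f"
  by (simp add: avg_def sum_distrib_left)

lemma avg_sum: "avg I (\<lambda>e. \<Sum>a\<in>A. f a e) = (\<Sum>a\<in>A. avg I (f a))"
proof -
  have "(\<Sum>e\<in>sgns I. \<Sum>a\<in>A. f a e) = (\<Sum>a\<in>A. \<Sum>e\<in>sgns I. f a e)"
    by (rule sum.swap)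
  then show ?thesis
    by (simp add: avg_def sum_divide_distrib)
qed

lemma avg_flip:
  assumes "i \<in> I"
  shows "avg I (\<lambda>e. f (flip i e)) = avg I f"
proof -
  have "(\<Sum>e\<in>sgns I. f (flip i e)) = (\<Sum>e\<in>sgns I. f e)"
    by (rule sum.reindex_bij_witness[of _ "flip i" "flip i"]) (auto intro: flip_in_sgns assms)
  then show ?thesis
    by (simp add: avg_def)
qed

text \<open>Conditioning on all coordinates except \<open>i\<close>. Every pivot argument below
  rests on this step.\<close>

lemma avg_symmetrize:
  assumes "i \<in> I"
  shows "avg I f = avg I (\<lambda>e. (f e + f (flip i e)) / 2)"
proof -
  have "avg I (\<lambda>e. (f e + f (flip i e)) / 2) = avg I (\<lambda>e. (1/2) * (f e + f (flip i e)))"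
    by simp
  also have "\<dots> = (1/2) * (avg I f + avg I f)"
    by (simp only: avg_cmult avg_add avg_flip[OF assms])
  finally show ?thesis by simp
qed

lemma avg_insert:
  assumes "finite I" "i \<notin> I"
  shows "avg (insert i I) f = avg I (\<lambda>e. (f (e(i := 1)) + f (e(i := -1))) / 2)"
proof -
  have inj: "inj_on (\<lambda>(y, g). g(i := y)) ({-1, 1::real} \<times> sgns I)"
  proof (rule inj_onI, clarify)
    fix y g z h
    assume g: "g \<in> sgns I" and h: "h \<in> sgns I" and eq: "g(i := y) = h(i := (z::real))"
    have "g j = h j" for j
    proof (cases "j = i")
      case True
      then show ?thesis
        using g h assms by (auto simp: sgns_def PiE_def extensional_def)
    next
      case False
      then show ?thesis using fun_cong[OF eq, of j] by simp
    qed
    moreover have "y = z" using fun_cong[OF eq, of i] by simp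
    ultimately show "y = z \<and> g = h" by auto
  qed
  have "sgns (insert i I) = (\<lambda>(y, g). g(i := y)) ` ({-1, 1} \<times> sgns I)"
    unfolding sgns_def by (rule PiE_insert_eq)
  then have "(\<Sum>e\<in>sgns (insert i I). f e) = (\<Sum>(y, g)\<in>{-1, 1} \<times> sgns I. f (g(i := y)))"
    using sum.reindex[OF inj, of f] by (simp add: case_prod_unfold o_def)
  also have "\<dots> = (\<Sum>g\<in>sgns I. f (g(i := 1)) + f (g(i := -1)))"
    by (subst sum.cartesian_product[symmetric]) (simp add: sum.distrib add.commute)
  finally show ?thesis
    using assms by (simp add: avg_def sum_divide_distrib[symmetric])
qed

section \<open>Elementary inequalities for hyperbolic functions\<close>

lemma self_le_sinh: "0 \<le> t \<Longrightarrow> (t::real) \<le> sinh t"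
proof -
  assume t: "0 \<le> t"
  have "(\<lambda>x. sinh x - x) 0 \<le> (\<lambda>x. sinh x - x) t"
    using t
  proof (rule DERIV_nonneg_imp_nondecreasing)
    fix x :: real
    show "\<exists>y. ((\<lambda>x. sinh x - x) has_real_derivative y) (at x) \<and> 0 \<le> y"
      by (rule exI[of _ "cosh x - 1"]) (auto intro!: derivative_eq_intros simp: cosh_real_ge_1)
  qed
  then show ?thesis by simp
qed

text \<open>Half-angle formula: cosh t = 1 + 2 sinh^2 (t/2). It keeps the exponential moment of a
  walk from below, where \<open>cosh_le_exp\<close> bounds it from above.\<close>

lemma cosh_ge_one_plus: "1 + t\<^sup>2 / 2 \<le> cosh (t::real)"
proof -
  have "(\<bar>t\<bar> / 2)\<^sup>2 \<le> (sinh (\<bar>t\<bar> / 2))\<^sup>2"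
    by (intro power_mono self_le_sinh) auto
  then show ?thesis
    using cosh_double[of "\<bar>t\<bar> / 2"] by (simp add: cosh_square_eq power_divide)
qed

lemma tanh_le_self: "0 \<le> t \<Longrightarrow> tanh t \<le> (t::real)"
proof -
  assume t: "0 \<le> t"
  have "(\<lambda>x. x - tanh x) 0 \<le> (\<lambda>x. x - tanh x) t"
    using t
  proof (rule DERIV_nonneg_imp_nondecreasing)
    fix x :: real
    assume "0 \<le> x"
    show "\<exists>y. ((\<lambda>x. x - tanh x) has_real_derivative y) (at x) \<and> 0 \<le> y"
      by (rule exI[of _ "tanh x ^ 2"]) (auto intro!: derivative_eq_intros)
  qed
  then show ?thesis by simp
qed

lemma cosh_le_exp: "cosh (t::real) \<le> exp (t\<^sup>2 / 2)"
proof -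
  have *: "cosh t \<le> exp (t\<^sup>2 / 2)" if t: "0 \<le> t" for t :: real
  proof -
    have "(\<lambda>x. x\<^sup>2 / 2 - ln (cosh x)) 0 \<le> (\<lambda>x. x\<^sup>2 / 2 - ln (cosh x)) t"
      using t
    proof (rule DERIV_nonneg_imp_nondecreasing)
      fix x :: real
      assume "0 \<le> x"
      then show "\<exists>y. ((\<lambda>x. x\<^sup>2 / 2 - ln (cosh x)) has_real_derivative y) (at x) \<and> 0 \<le> y"
        by (intro exI[of _ "x - tanh x"])
          (auto intro!: derivative_eq_intros simp: tanh_def tanh_le_self[unfolded tanh_def])
    qed
    then have "ln (cosh t) \<le> t\<^sup>2 / 2" by simp
    then show ?thesis
      by (metis cosh_real_pos exp_le_cancel_iff exp_ln)
  qed
  show ?thesis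
    using *[of "\<bar>t\<bar>"] by simp
qed

text \<open>Induction on the coordinates: averaging one of them out preserves the bounded
  differences, and the two values it produces lie at distance at most c from their mean, which costs
  a factor cosh (s h) with |h| <= c.\<close>

lemma avg_exp_bounded_differences:
  fixes f :: "('i \<Rightarrow> real) \<Rightarrow> real"
  assumes "finite I"
    and "\<And>i e. i \<in> I \<Longrightarrow> e \<in> sgns I \<Longrightarrow> \<bar>f (flip i e) - f e\<bar> \<le> 2 * c"
  shows "avg I (\<lambda>e. exp (s * f e)) \<le> exp (s * avg I f + s\<^sup>2 * c\<^sup>2 * card I / 2)"
  using assms
proof (induction I arbitrary: f rule: finite_induct)
  case empty
  then show ?case by (simp add: avg_def sgns_def)
next
  case (insert i I)
  \<comment> \<open>The conditional mean of \<open>f\<close> given the coordinates in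
    \<open>I\<close>.\<close>
  define g where "g e = (f (e(i := 1)) + f (e(i := -1))) / 2" for e
  have upd: "e(i := y) \<in> sgns (insert i I)" if "e \<in> sgns I" "y \<in> {-1, 1}" for e y
    using that insert.hyps by (auto simp: sgns_def PiE_def Pi_def extensional_def)
  have bd: "\<bar>f (e(i := 1)) - f (e(i := -1))\<bar> \<le> 2 * c" if "e \<in> sgns I" for e
  proof -
    have "flip i (e(i := -1)) = e(i := 1)" by (simp add: flip_def)
    then show ?thesis
      using insert.prems(1)[OF insertI1 upd[OF that, of "-1"]] by (simp del: fun_upd_apply)
  qed
  have gbd: "\<bar>g (flip j e) - g e\<bar> \<le> 2 * c" if "j \<in> I" "e \<in> sgns I" for j e
  proof -
    have "j \<noteq> i" using that insert.hyps by auto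
    then have tw: "(flip j e)(i := y) = flip j (e(i := y))" for y
      by (auto simp: flip_def fun_upd_def)
    have "\<bar>f ((flip j e)(i := 1)) - f (e(i := 1))\<bar> \<le> 2 * c"
      "\<bar>f ((flip j e)(i := -1)) - f (e(i := -1))\<bar> \<le> 2 * c"
      unfolding tw using insert.prems(1)[OF insertI2[OF that(1)] upd[OF that(2)]] by blast+
    moreover have "\<bar>(a + b) / 2 - (a' + b') / 2\<bar> \<le> r" if "\<bar>a - a'\<bar> \<le> r" "\<bar>b - b'\<bar> \<le> r" for a b a' b' r :: real
      using that by (simp add: abs_le_iff field_simps)
    ultimately show ?thesis unfolding g_def by blast
  qed
  have "avg (insert i I) (\<lambda>e. exp (s * f e)) =
      avg I (\<lambda>e. (exp (s * f (e(i := 1))) + exp (s * f (e(i := -1)))) / 2)"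
    by (rule avg_insert) (use insert.hyps in auto)
  also have "\<dots> \<le> avg I (\<lambda>e. exp (s\<^sup>2 * c\<^sup>2 / 2) * exp (s * g e))"
  proof (rule avg_mono)
    fix e assume w: "e \<in> sgns I"
    define h where "h = (f (e(i := 1)) - f (e(i := -1))) / 2"
    have f1: "f (e(i := 1)) = g e + h" and f2: "f (e(i := -1)) = g e - h"
      by (simp_all add: g_def h_def field_simps)
    have "(exp (s * f (e(i := 1))) + exp (s * f (e(i := -1)))) / 2 = cosh (s * h) * exp (s * g e)"
      unfolding f1 f2 by (simp add: cosh_field_def ring_distribs exp_add exp_diff exp_minus field_simps)
    also have "\<dots> \<le> exp ((s * h)\<^sup>2 / 2) * exp (s * g e)"
      by (intro mult_right_mono cosh_le_exp) auto
    also have "\<dots> \<le> exp (s\<^sup>2 * c\<^sup>2 / 2) * exp (s * g e)"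
    proof -
      have "\<bar>h\<bar> \<le> c" using bd[OF w] by (simp add: h_def)
      then have "h\<^sup>2 \<le> c\<^sup>2" by (rule abs_le_square_iff[THEN iffD1, OF order_trans]) simp
      then have "(s * h)\<^sup>2 \<le> s\<^sup>2 * c\<^sup>2" by (simp add: power_mult_distrib mult_left_mono)
      then show ?thesis by simp
    qed
    finally show "(exp (s * f (e(i := 1))) + exp (s * f (e(i := -1)))) / 2
        \<le> exp (s\<^sup>2 * c\<^sup>2 / 2) * exp (s * g e)" .
  qed
  also have "\<dots> = exp (s\<^sup>2 * c\<^sup>2 / 2) * avg I (\<lambda>e. exp (s * g e))"
    by (rule avg_cmult)
  also have "\<dots> \<le> exp (s\<^sup>2 * c\<^sup>2 / 2) * exp (s * avg I g + s\<^sup>2 * c\<^sup>2 * card I / 2)"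
    by (intro mult_left_mono insert.IH gbd) auto
  also have "\<dots> = exp (s * avg I g + s\<^sup>2 * c\<^sup>2 * card (insert i I) / 2)"
    using insert.hyps by (simp add: mult_exp_exp field_simps)
  also have "avg I g = avg (insert i I) f"
    unfolding g_def by (rule avg_insert[symmetric]) (use insert.hyps in auto)
  finally show ?case .
qed

text \<open>McDiarmid's inequality; the free parameter is optimised to $s = x / (c^2 |I|)$.\<close>

lemma avg_concentration:
  fixes f :: "('i \<Rightarrow> real) \<Rightarrow> real"
  assumes I: "finite I" "I \<noteq> {}" and c: "c > 0"
    and bd: "\<And>i e. i \<in> I \<Longrightarrow> e \<in> sgns I \<Longrightarrow> \<bar>f (flip i e) - f e\<bar> \<le> 2 * c"
    and x: "x \<ge> 0"
  shows "avg I (\<lambda>e. of_bool (f e \<ge> avg I f + x)) \<le> exp (- x\<^sup>2 / (2 * c\<^sup>2 * card I))"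
proof -
  define K where "K = c\<^sup>2 * card I"
  have K: "K > 0" using I c by (simp add: K_def card_gt_0_iff)
  define s where "s = x / K"
  have s: "s \<ge> 0" using x K by (simp add: s_def)
  have "avg I (\<lambda>e. of_bool (f e \<ge> avg I f + x)) \<le> avg I (\<lambda>e. exp (- s * (avg I f + x)) * exp (s * f e))"
  proof (rule avg_mono)
    fix e
    show "of_bool (f e \<ge> avg I f + x) \<le> exp (- s * (avg I f + x)) * exp (s * f e)"
      using mult_left_mono[OF _ s, of "avg I f + x" "f e"] by (auto simp: mult_exp_exp)
  qed
  also have "\<dots> = exp (- s * (avg I f + x)) * avg I (\<lambda>e. exp (s * f e))"
    by (rule avg_cmult)
  also have "\<dots> \<le> exp (- s * (avg I f + x)) * exp (s * avg I f + s\<^sup>2 * c\<^sup>2 * card I / 2)"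
    by (intro mult_left_mono avg_exp_bounded_differences assms) auto
  also have "\<dots> = exp (s\<^sup>2 * K / 2 - s * x)"
    by (simp add: mult_exp_exp K_def algebra_simps)
  also have "s\<^sup>2 * K / 2 - s * x = - x\<^sup>2 / (2 * c\<^sup>2 * card I)"
  proof -
    have "s\<^sup>2 * K / 2 - s * x = - x\<^sup>2 / (2 * K)"
      using K unfolding s_def by (simp add: power2_eq_square field_simps)
    then show ?thesis by (simp add: K_def mult.assoc)
  qed
  finally show ?thesis .
qed


section \<open>Walks with independent signs\<close>

text \<open>Flipping the pivot p j negates the j-th step and leaves all earlier steps alone, so that
  the steps are independent uniform signs.\<close>

definition sign_walk :: "'i set \<Rightarrow> nat \<Rightarrow> (nat \<Rightarrow> 'i) \<Rightarrow> (nat \<Rightarrow> ('i \<Rightarrow> real) \<Rightarrow> real) \<Rightarrow> bool" where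
  "sign_walk I n p x \<longleftrightarrow> (\<forall>j<n. p j \<in> I \<and> (\<forall>e\<in>sgns I. (x j e = 1 \<or> x j e = -1) \<and>
     x j (flip (p j) e) = - x j e \<and> (\<forall>i<j. x i (flip (p j) e) = x i e)))"

lemma sign_walk_uminus: "sign_walk I n p x \<Longrightarrow> sign_walk I n p (\<lambda>j e. - x j e)"
  unfolding sign_walk_def by (metis minus_minus)

lemma sign_walk_le: "sign_walk I n p x \<Longrightarrow> m \<le> n \<Longrightarrow> sign_walk I m p x"
  unfolding sign_walk_def by auto

text \<open>Replaces independence: symmetrising in the last pivot leaves the earlier factors alone
  and turns the last one into its conditional mean c, which comes out of the average.\<close>

lemma avg_prod_pivot:
  assumes "finite I"
    and "\<And>j. j < n \<Longrightarrow> p j \<in> I"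
    and "\<And>i j e. i < j \<Longrightarrow> j < n \<Longrightarrow> e \<in> sgns I \<Longrightarrow> \<phi> i (flip (p j) e) = \<phi> i e"
    and "\<And>j e. j < n \<Longrightarrow> e \<in> sgns I \<Longrightarrow> \<phi> j e + \<phi> j (flip (p j) e) = 2 * c"
  shows "avg I (\<lambda>e. \<Prod>j<n. \<phi> j e) = c ^ n"
  using assms
proof (induction n)
  case 0
  then show ?case by (simp add: avg_const)
next
  case (Suc n)
  have "avg I (\<lambda>e. \<Prod>j<Suc n. \<phi> j e) =
      avg I (\<lambda>e. ((\<Prod>j<Suc n. \<phi> j e) + (\<Prod>j<Suc n. \<phi> j (flip (p n) e))) / 2)"
    by (rule avg_symmetrize) (use Suc.prems in auto)
  also have "\<dots> = avg I (\<lambda>e. c * (\<Prod>j<n. \<phi> j e))"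
  proof (rule avg_cong)
    fix e assume e: "e \<in> sgns I"
    have "(\<Prod>j<n. \<phi> j (flip (p n) e)) = (\<Prod>j<n. \<phi> j e)"
      by (rule prod.cong) (use Suc.prems(3) e in auto)
    then have "((\<Prod>j<Suc n. \<phi> j e) + (\<Prod>j<Suc n. \<phi> j (flip (p n) e))) / 2 =
        (\<Prod>j<n. \<phi> j e) * ((\<phi> n e + \<phi> n (flip (p n) e)) / 2)"
      by (simp add: field_simps)
    also have "\<dots> = c * (\<Prod>j<n. \<phi> j e)"
      using Suc.prems(4)[of n e] e by simp
    finally show "((\<Prod>j<Suc n. \<phi> j e) + (\<Prod>j<Suc n. \<phi> j (flip (p n) e))) / 2 = c * (\<Prod>j<n. \<phi> j e)" .
  qed
  also have "\<dots> = c * c ^ n"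
    by (subst avg_cmult, subst Suc.IH) (use Suc.prems in auto)
  finally show ?case by simp
qed

section \<open>Exponential moments and tails of the endpoint\<close>

lemma sign_walk_mgf:
  assumes I: "finite I" and w: "sign_walk I n p x"
  shows "avg I (\<lambda>e. exp (t * (\<Sum>j<n. x j e))) = cosh t ^ n"
proof -
  have "avg I (\<lambda>e. \<Prod>j<n. exp (t * x j e)) = cosh t ^ n"
  proof (rule avg_prod_pivot[where p = p])
    fix j e assume "j < n" "e \<in> sgns I"
    then have "x j (flip (p j) e) = - x j e" "x j e = 1 \<or> x j e = -1"
      using w by (auto simp: sign_walk_def)
    then show "exp (t * x j e) + exp (t * x j (flip (p j) e)) = 2 * cosh t"
      by (auto simp: cosh_field_def)
  qed (use I w in \<open>auto simp: sign_walk_def\<close>)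
  then show ?thesis
    by (simp add: exp_sum sum_distrib_left)
qed

lemma cosh_power_le_exp: "cosh (t::real) ^ n \<le> exp (n * t\<^sup>2 / 2)"
proof -
  have "cosh t ^ n \<le> exp (t\<^sup>2 / 2) ^ n"
    by (intro power_mono cosh_le_exp) auto
  also have "\<dots> = exp (n * t\<^sup>2 / 2)"
    by (simp add: exp_of_nat_mult[symmetric])
  finally show ?thesis .
qed

lemma sign_walk_upper_tail:
  assumes I: "finite I" and w: "sign_walk I n p x" and n: "n > 0" and b: "b \<ge> 0"
  shows "avg I (\<lambda>e. of_bool (b \<le> (\<Sum>j<n. x j e))) \<le> exp (- b\<^sup>2 / (2 * real n))"
proof -
  \<comment> \<open>The minimiser of n t^2 / 2 - t b.\<close>
  define t where "t = b / n"
  have t: "t \<ge> 0" using b by (simp add: t_def)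
  have "avg I (\<lambda>e. of_bool (b \<le> (\<Sum>j<n. x j e))) \<le> avg I (\<lambda>e. exp (- t * b) * exp (t * (\<Sum>j<n. x j e)))"
  proof (rule avg_mono)
    fix e
    show "of_bool (b \<le> (\<Sum>j<n. x j e)) \<le> exp (- t * b) * exp (t * (\<Sum>j<n. x j e))"
      using mult_left_mono[OF _ t, of b "\<Sum>j<n. x j e"] by (auto simp: mult_exp_exp)
  qed
  also have "\<dots> = exp (- t * b) * cosh t ^ n"
    by (simp only: avg_cmult sign_walk_mgf[OF I w])
  also have "\<dots> \<le> exp (- t * b) * exp (n * t\<^sup>2 / 2)"
    by (intro mult_left_mono cosh_power_le_exp) auto
  also have "\<dots> = exp (- b\<^sup>2 / (2 * real n))"
    using n by (simp add: mult_exp_exp t_def power2_eq_square field_simps)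
  finally show ?thesis .
qed

text \<open>The walk reflected at 0 dominates all increments of the walk that end now. It is frozen once
  it reaches the level l; while it moves, cosh (t y) grows on average by a factor of at most cosh t,
  even in the reflecting step, because cosh (max 0 y) is at most cosh y.\<close>

primrec reflected :: "real \<Rightarrow> (nat \<Rightarrow> real) \<Rightarrow> nat \<Rightarrow> real" where
  "reflected l y 0 = 0"
| "reflected l y (Suc n) =
     (if reflected l y n \<ge> l then reflected l y n else max 0 (reflected l y n + y n))"

lemma reflected_nonneg: "0 \<le> reflected l y n"
  by (induction n) auto

lemma reflected_frozen: "l \<le> reflected l y m \<Longrightarrow> m \<le> n \<Longrightarrow> l \<le> reflected l y n"
  by (induction n) (auto simp: le_Suc_eq)

lemma reflected_cong: "(\<And>j. j < n \<Longrightarrow> y j = z j) \<Longrightarrow> reflected l y n = reflected l z n"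
  by (induction n) auto

text \<open>The reflected walk is nonnegative at time u, and as long as it is not frozen each step
  raises it by at least \<open>y j\<close>. Staying below l at the final time n excludes freezing
  earlier.\<close>

lemma increment_le_reflected:
  assumes "reflected l y n < l" "v \<le> n" "u \<le> v"
  shows "(\<Sum>j=u..<v. y j) \<le> reflected l y v"
  using assms(3,2)
proof (induction v rule: dec_induct)
  case base
  then show ?case by (simp add: reflected_nonneg)
next
  case (step v)
  have "\<not> l \<le> reflected l y v"
    using reflected_frozen[of l y v n] assms(1) step.prems by auto
  then show ?case
    using step by (auto simp: sum.atLeastLessThan_Suc)
qed

lemma avg_cosh_reflected:
  assumes I: "finite I" and w: "sign_walk I n p x"
  shows "avg I (\<lambda>e. cosh (t * reflected l (\<lambda>j. x j e) n)) \<le> cosh t ^ n"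
  using w
proof (induction n)
  case 0
  then show ?case by (simp add: avg_const[OF I])
next
  case (Suc n)
  let ?y = "\<lambda>e. reflected l (\<lambda>j. x j e)"
  \<comment> \<open>This is why cosh replaces exp: for z < 0 < t the reflection would raise exp (t
    z) to 1, whereas cosh is even and has its minimum at 0.\<close>
  have cosh_max: "cosh (t * max 0 z) \<le> cosh (t * z)" for z
    using cosh_real_ge_1[of "t * z"] by (auto simp: max_def)
  have "avg I (\<lambda>e. cosh (t * ?y e (Suc n))) =
      avg I (\<lambda>e. (cosh (t * ?y e (Suc n)) + cosh (t * ?y (flip (p n) e) (Suc n))) / 2)"
    by (rule avg_symmetrize) (use Suc.prems in \<open>auto simp: sign_walk_def\<close>)
  also have "\<dots> \<le> avg I (\<lambda>e. cosh t * cosh (t * ?y e n))"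
  proof (rule avg_mono)
    fix e assume e: "e \<in> sgns I"
    have same: "?y (flip (p n) e) n = ?y e n"
      by (rule reflected_cong) (use Suc.prems e in \<open>auto simp: sign_walk_def\<close>)
    have x: "x n (flip (p n) e) = - x n e" "x n e = 1 \<or> x n e = -1"
      using Suc.prems e by (auto simp: sign_walk_def)
    show "(cosh (t * ?y e (Suc n)) + cosh (t * ?y (flip (p n) e) (Suc n))) / 2 \<le> cosh t * cosh (t * ?y e n)"
    proof (cases "l \<le> ?y e n")
      case True
      then show ?thesis
        using mult_right_mono[OF cosh_real_ge_1[of t], of "cosh (t * ?y e n)"] by (simp add: same)
    next
      case False
      have "cosh (t * ?y e (Suc n)) + cosh (t * ?y (flip (p n) e) (Suc n))
          \<le> cosh (t * (?y e n + x n e)) + cosh (t * (?y e n - x n e))"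
        using False cosh_max[of "?y e n + x n e"] cosh_max[of "?y e n - x n e"] by (simp add: same x(1))
      also have "\<dots> = cosh (t * ?y e n + t) + cosh (t * ?y e n - t)"
        using x(2) by (auto simp: ring_distribs)
      also have "\<dots> = 2 * (cosh t * cosh (t * ?y e n))"
        by (simp add: cosh_add cosh_diff)
      finally show ?thesis by simp
    qed
  qed
  also have "\<dots> = cosh t * avg I (\<lambda>e. cosh (t * ?y e n))"
    by (rule avg_cmult)
  also have "\<dots> \<le> cosh t * cosh t ^ n"
    by (intro mult_left_mono Suc.IH sign_walk_le[OF Suc.prems]) auto
  finally show ?case by simp
qed

text \<open>Markov's inequality at the single time n. Reflection at 0 accounts for all starting
  times u, freezing at l for all end times v, so the maximum over both costs nothing in the
  exponent.\<close>

lemma sign_walk_increment_tail: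
  assumes I: "finite I" and w: "sign_walk I n p x" and t: "t \<ge> 0" and l: "l > 0"
  shows "avg I (\<lambda>e. of_bool (\<exists>u v. u \<le> v \<and> v \<le> n \<and> l \<le> (\<Sum>j=u..<v. x j e))) \<le> cosh t ^ n / cosh (t * l)"
proof -
  let ?y = "\<lambda>e. reflected l (\<lambda>j. x j e) n"
  have "avg I (\<lambda>e. of_bool (\<exists>u v. u \<le> v \<and> v \<le> n \<and> l \<le> (\<Sum>j=u..<v. x j e)))
      \<le> avg I (\<lambda>e. 1 / cosh (t * l) * cosh (t * ?y e))"
  proof (rule avg_mono)
    fix e
    show "of_bool (\<exists>u v. u \<le> v \<and> v \<le> n \<and> l \<le> (\<Sum>j=u..<v. x j e)) \<le> 1 / cosh (t * l) * cosh (t * ?y e)"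
    proof (cases "\<exists>u v. u \<le> v \<and> v \<le> n \<and> l \<le> (\<Sum>j=u..<v. x j e)")
      case True
      then obtain u v where uv: "u \<le> v" "v \<le> n" "l \<le> (\<Sum>j=u..<v. x j e)" by blast
      have "l \<le> ?y e"
      proof (rule ccontr)
        assume "\<not> l \<le> ?y e"
        then have "?y e < l" by simp
        from increment_le_reflected[OF this uv(2,1)] uv(3)
        have "l \<le> reflected l (\<lambda>j. x j e) v" by simp
        with \<open>\<not> l \<le> ?y e\<close> uv(2) reflected_frozen show False by blast
      qed
      then have "t * l \<le> t * ?y e" using t by (rule mult_left_mono)
      then have "cosh (t * l) \<le> cosh (t * ?y e)"
        using t l by (simp add: cosh_real_nonneg_le_iff reflected_nonneg)
      then show ?thesis using True by (simp add: field_simps)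
    qed auto
  qed
  also have "\<dots> = 1 / cosh (t * l) * avg I (\<lambda>e. cosh (t * ?y e))"
    by (rule avg_cmult)
  also have "\<dots> \<le> 1 / cosh (t * l) * cosh t ^ n"
    by (intro mult_left_mono avg_cosh_reflected[OF I w]) auto
  finally show ?thesis by simp
qed

text \<open>The factor 4 is 2 for the two signs of the walk times 2 from cosh z >= exp z / 2. The
  number of steps is relaxed to N because it will depend on the pattern, whereas the union bound
  wants one common bound.\<close>

lemma sign_walk_abs_increment_tail:
  assumes I: "finite I" and w: "sign_walk I n p x" and n: "n \<le> N" "N > 0" and l: "l > 0"
  shows "avg I (\<lambda>e. of_bool (\<exists>u v. u \<le> v \<and> v \<le> n \<and> l \<le> \<bar>\<Sum>j=u..<v. x j e\<bar>)) \<le> 4 * exp (- l\<^sup>2 / (2 * real N))"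
proof -
  define t where "t = l / N"
  have t: "t \<ge> 0" using l by (simp add: t_def)
  have cosh_lower: "exp z / 2 \<le> cosh z" for z :: real
    by (simp add: cosh_field_def)
  have "cosh t ^ n \<le> cosh t ^ N"
    by (intro power_increasing n cosh_real_ge_1)
  also have "\<dots> \<le> exp (N * t\<^sup>2 / 2)"
    by (rule cosh_power_le_exp)
  finally have "cosh t ^ n / cosh (t * l) \<le> exp (N * t\<^sup>2 / 2) / (exp (t * l) / 2)"
    by (intro frac_le cosh_lower) auto
  also have "\<dots> = 2 * exp (N * t\<^sup>2 / 2 - t * l)"
    by (simp add: exp_diff)
  also have "N * t\<^sup>2 / 2 - t * l = - l\<^sup>2 / (2 * real N)"
    using n(2) by (simp add: t_def power2_eq_square field_simps)
  finally have T: "cosh t ^ n / cosh (t * l) \<le> 2 * exp (- l\<^sup>2 / (2 * real N))" .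
  let ?P = "\<lambda>y e. \<exists>u v. u \<le> v \<and> v \<le> n \<and> l \<le> (\<Sum>j=u..<v. y j e)"
  have "avg I (\<lambda>e. of_bool (\<exists>u v. u \<le> v \<and> v \<le> n \<and> l \<le> \<bar>\<Sum>j=u..<v. x j e\<bar>))
      \<le> avg I (\<lambda>e. of_bool (?P x e) + of_bool (?P (\<lambda>j e. - x j e) e))"
  proof (rule avg_mono)
    fix e
    have "?P x e \<or> ?P (\<lambda>j e. - x j e) e" if "\<exists>u v. u \<le> v \<and> v \<le> n \<and> l \<le> \<bar>\<Sum>j=u..<v. x j e\<bar>"
      using that by (auto simp: sum_negf abs_if split: if_splits)
    then show "of_bool (\<exists>u v. u \<le> v \<and> v \<le> n \<and> l \<le> \<bar>\<Sum>j=u..<v. x j e\<bar>)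
        \<le> (of_bool (?P x e) + of_bool (?P (\<lambda>j e. - x j e) e) :: real)"
      by (cases "?P x e"; cases "?P (\<lambda>j e. - x j e) e") auto
  qed
  also have "\<dots> \<le> 2 * exp (- l\<^sup>2 / (2 * real N)) + 2 * exp (- l\<^sup>2 / (2 * real N))"
    unfolding avg_add
    by (intro add_mono order_trans[OF sign_walk_increment_tail[OF I w t l] T]
        order_trans[OF sign_walk_increment_tail[OF I sign_walk_uminus[OF w] t l] T])
  finally show ?thesis by simp
qed

text \<open>Chernoff bounds under the tilted measure: on the event in question the additional factor
  exp (h (X - b)), respectively exp (h (b - X)), is at least 1.\<close>

lemma exp_times_upper_tail_le:
  fixes h t :: real
  assumes I: "finite I" and w: "sign_walk I n p x" and h: "h \<ge> 0"
  shows "avg I (\<lambda>e. of_bool (b \<le> (\<Sum>j<n. x j e)) * exp (t * (\<Sum>j<n. x j e)))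
           \<le> exp (n * (t + h)\<^sup>2 / 2 - h * b)"
    and "avg I (\<lambda>e. of_bool ((\<Sum>j<n. x j e) \<le> b) * exp (t * (\<Sum>j<n. x j e)))
           \<le> exp (n * (t - h)\<^sup>2 / 2 + h * b)"
proof -
  have *: "exp (- (h * b)) * cosh (t + h) ^ n \<le> exp (n * (t + h)\<^sup>2 / 2 - h * b)" for h
    using mult_left_mono[OF cosh_power_le_exp[of "t + h" n], of "exp (- (h * b))"]
    by (simp add: mult_exp_exp algebra_simps)
  have "avg I (\<lambda>e. of_bool (b \<le> (\<Sum>j<n. x j e)) * exp (t * (\<Sum>j<n. x j e)))
      \<le> avg I (\<lambda>e. exp (- (h * b)) * exp ((t + h) * (\<Sum>j<n. x j e)))"
    by (rule avg_mono) (use h in \<open>auto simp: mult_exp_exp ring_distribs mult_left_mono\<close>)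
  also have "\<dots> = exp (- (h * b)) * cosh (t + h) ^ n"
    by (simp only: avg_cmult sign_walk_mgf[OF I w])
  also note *[of h]
  finally show "avg I (\<lambda>e. of_bool (b \<le> (\<Sum>j<n. x j e)) * exp (t * (\<Sum>j<n. x j e)))
           \<le> exp (n * (t + h)\<^sup>2 / 2 - h * b)" .
  have "avg I (\<lambda>e. of_bool ((\<Sum>j<n. x j e) \<le> b) * exp (t * (\<Sum>j<n. x j e)))
      \<le> avg I (\<lambda>e. exp (- (- h * b)) * exp ((t + - h) * (\<Sum>j<n. x j e)))"
    by (rule avg_mono) (use h in \<open>auto simp: mult_exp_exp ring_distribs mult_left_mono\<close>)
  also have "\<dots> = exp (- (- h * b)) * cosh (t + - h) ^ n"
    by (simp only: avg_cmult sign_walk_mgf[OF I w])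
  also note *[of "- h"]
  finally show "avg I (\<lambda>e. of_bool ((\<Sum>j<n. x j e) \<le> b) * exp (t * (\<Sum>j<n. x j e)))
           \<le> exp (n * (t - h)\<^sup>2 / 2 + h * b)"
    by simp
qed

text \<open>Under the measure with density proportional to exp (t X) the endpoint X concentrates near
  n t, where the density is known up to the factor exp (d n t^2).\<close>

lemma sign_walk_lower_tail:
  fixes t d :: real
  assumes I: "finite I" and w: "sign_walk I n p x" and t: "t > 0" and d: "0 < d" "d < 1"
  shows "exp (- (1 + d) * n * t\<^sup>2) * (cosh t ^ n - 2 * exp (n * t\<^sup>2 / 2 * (1 - d\<^sup>2)))
           \<le> avg I (\<lambda>e. of_bool ((1 - d) * n * t \<le> (\<Sum>j<n. x j e)))"
proof -
  let ?X = "\<lambda>e. \<Sum>j<n. x j e"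
  let ?a = "(1 - d) * n * t" and ?b = "(1 + d) * n * t"
  have dt: "0 \<le> d * t" using t d by simp
  \<comment> \<open>The additional tilt h = d t makes both tails smaller than the full mass, about
    exp (n t^2 / 2), by the factor exp (- d^2 n t^2 / 2).\<close>
  have up: "avg I (\<lambda>e. of_bool (?b \<le> ?X e) * exp (t * ?X e)) \<le> exp (n * t\<^sup>2 / 2 * (1 - d\<^sup>2))"
  proof -
    have eq: "n * (t + d * t)\<^sup>2 / 2 - d * t * ?b = n * t\<^sup>2 / 2 * (1 - d\<^sup>2)"
      by (simp add: power2_eq_square field_simps)
    then show ?thesis
      using exp_times_upper_tail_le(1)[OF I w dt, of ?b t] by (simp only: eq)
  qed
  have lo: "avg I (\<lambda>e. of_bool (?X e \<le> ?a) * exp (t * ?X e)) \<le> exp (n * t\<^sup>2 / 2 * (1 - d\<^sup>2))"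
  proof -
    have eq: "n * (t - d * t)\<^sup>2 / 2 + d * t * ?a = n * t\<^sup>2 / 2 * (1 - d\<^sup>2)"
      by (simp add: power2_eq_square field_simps)
    then show ?thesis
      using exp_times_upper_tail_le(2)[OF I w dt, of ?a t] by (simp only: eq)
  qed
  have "cosh t ^ n = avg I (\<lambda>e. exp (t * ?X e))"
    by (rule sign_walk_mgf[OF I w, symmetric])
  \<comment> \<open>The tilted mass splits into two tails and the window from \<open>?a\<close> to
    \<open>?b\<close>, where the density is at most exp (t ?b).\<close>
  also have "\<dots> \<le> avg I (\<lambda>e. (of_bool (?b \<le> ?X e) * exp (t * ?X e) + of_bool (?X e \<le> ?a) * exp (t * ?X e)) +
      exp (t * ?b) * of_bool (?a \<le> ?X e))"
  proof (rule avg_mono)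
    fix e
    consider "?b \<le> ?X e" | "?X e \<le> ?a" | "?a \<le> ?X e" "?X e \<le> ?b" by linarith
    then show "exp (t * ?X e) \<le> (of_bool (?b \<le> ?X e) * exp (t * ?X e) + of_bool (?X e \<le> ?a) * exp (t * ?X e)) +
      exp (t * ?b) * of_bool (?a \<le> ?X e)"
    proof cases
      case 3
      then have "exp (t * ?X e) \<le> exp (t * ?b)" using t by simp
      then show ?thesis using 3 by (auto intro: order_trans add_increasing)
    qed (auto simp: add_increasing add_increasing2)
  qed
  also have "\<dots> \<le> (exp (n * t\<^sup>2 / 2 * (1 - d\<^sup>2)) + exp (n * t\<^sup>2 / 2 * (1 - d\<^sup>2))) +
      exp (t * ?b) * avg I (\<lambda>e. of_bool (?a \<le> ?X e))"
    unfolding avg_add avg_cmult using up lo by simp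
  finally have "cosh t ^ n - 2 * exp (n * t\<^sup>2 / 2 * (1 - d\<^sup>2)) \<le> exp (t * ?b) * avg I (\<lambda>e. of_bool (?a \<le> ?X e))"
    by simp
  then have "exp (- (t * ?b)) * (cosh t ^ n - 2 * exp (n * t\<^sup>2 / 2 * (1 - d\<^sup>2)))
      \<le> exp (- (t * ?b)) * (exp (t * ?b) * avg I (\<lambda>e. of_bool (?a \<le> ?X e)))"
    by (rule mult_left_mono) simp
  also have "\<dots> = avg I (\<lambda>e. of_bool (?a \<le> ?X e))"
    by (simp add: mult.assoc[symmetric] mult_exp_exp)
  also have "- (t * ?b) = - (1 + d) * n * t\<^sup>2"
    by (simp add: power2_eq_square algebra_simps)
  finally show ?thesis .
qed

text \<open>Two walks driven by the same pivots: given the past, the sum of their steps is twice a fair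
  sign or zero, according to the sign of x y, whence the weights below have mean 1.\<close>

lemma avg_pair_weight:
  assumes I: "finite I" and x: "sign_walk I n p x" and y: "sign_walk I n p y"
  shows "avg I (\<lambda>e. \<Prod>j<n. exp (t * (x j e + y j e)) / ((cosh t)\<^sup>2 * (1 + (tanh t)\<^sup>2 * (x j e * y j e)))) = 1"
proof -
  have "avg I (\<lambda>e. \<Prod>j<n. exp (t * (x j e + y j e)) / ((cosh t)\<^sup>2 * (1 + (tanh t)\<^sup>2 * (x j e * y j e)))) = 1 ^ n"
  proof (rule avg_prod_pivot[where p = p])
    fix j e assume je: "j < n" "e \<in> sgns I"
    have ct: "(cosh t)\<^sup>2 * (tanh t)\<^sup>2 = (sinh t)\<^sup>2"
      by (simp add: tanh_def power_divide)
    \<comment> \<open>The two possible denominators: cosh (2 t) for x y = 1, the mean of exp (2 t)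
      and exp (- 2 t), and 1 for x y = -1, where the numerator is 1. The flip negates both steps, so
      x y and with it the denominator is unchanged.\<close>
    have c1: "(cosh t)\<^sup>2 * (1 + (tanh t)\<^sup>2) = cosh (2 * t)"
      by (simp add: ring_distribs ct cosh_double)
    have c2: "(cosh t)\<^sup>2 * (1 - (tanh t)\<^sup>2) = 1"
      by (simp only: right_diff_distrib ct) (simp add: cosh_square_eq)
    have ch: "exp (2 * t) / cosh (2 * t) + exp (- (2 * t)) / cosh (2 * t) = 2"
    proof -
      have "exp (2 * t) + exp (- (2 * t)) = 2 * cosh (2 * t)" by (simp add: cosh_field_def)
      then show ?thesis by (simp add: add_divide_distrib[symmetric])
    qed
    have "x j (flip (p j) e) = - x j e" "y j (flip (p j) e) = - y j e"
      "x j e = 1 \<or> x j e = -1" "y j e = 1 \<or> y j e = -1"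
      using x y je by (auto simp: sign_walk_def)
    then show "exp (t * (x j e + y j e)) / ((cosh t)\<^sup>2 * (1 + (tanh t)\<^sup>2 * (x j e * y j e))) +
        exp (t * (x j (flip (p j) e) + y j (flip (p j) e))) /
          ((cosh t)\<^sup>2 * (1 + (tanh t)\<^sup>2 * (x j (flip (p j) e) * y j (flip (p j) e)))) = 2 * 1"
      using ch by (auto simp: c1 c2 mult.commute[of t 2])
  qed (use I x y in \<open>auto simp: sign_walk_def\<close>)
  then show ?thesis by simp
qed

text \<open>Markov's inequality for the weights of \<open>avg_pair_weight\<close>. By 1 + u <= exp u
  their denominators multiply to at most exp (n t^2 + t^2 W), where W is the sum of the products x
  y. As W is itself the endpoint of a walk, with pivots of its own, the case W >= b is handled by
  the endpoint tail; otherwise the correction to independence is exp (t^2 b).\<close>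

lemma sign_walk_pair_upper_tail:
  assumes I: "finite I" and x: "sign_walk I n p x" and y: "sign_walk I n p y"
    and xy: "sign_walk I n q (\<lambda>j e. x j e * y j e)"
    and t: "t \<ge> 0" and b: "b \<ge> 0" and n: "n > 0"
  shows "avg I (\<lambda>e. of_bool (l \<le> (\<Sum>j<n. x j e) \<and> l \<le> (\<Sum>j<n. y j e)))
           \<le> exp (- b\<^sup>2 / (2 * real n)) + exp (n * t\<^sup>2 + t\<^sup>2 * b - 2 * t * l)"
proof -
  let ?X = "\<lambda>e. \<Sum>j<n. x j e" and ?Y = "\<lambda>e. \<Sum>j<n. y j e" and ?W = "\<lambda>e. \<Sum>j<n. x j e * y j e"
  let ?g = "\<lambda>e. \<Prod>j<n. exp (t * (x j e + y j e)) / ((cosh t)\<^sup>2 * (1 + (tanh t)\<^sup>2 * (x j e * y j e)))"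
  \<comment> \<open>The reciprocal of a lower bound for the weight when both endpoints reach l and W
    < b.\<close>
  define C where "C = exp (n * t\<^sup>2 + t\<^sup>2 * b - 2 * t * l)"
  have tanh2: "(tanh t)\<^sup>2 \<le> t\<^sup>2"
    using t by (intro power_mono tanh_le_self) auto
  have tanh1: "(tanh t)\<^sup>2 < 1"
    using tanh_real_bounds[of t] by (simp add: abs_square_less_1 abs_less_iff)
  have main: "of_bool (l \<le> ?X e \<and> l \<le> ?Y e) \<le> of_bool (b \<le> ?W e) + C * ?g e" if e: "e \<in> sgns I" for e
  proof -
    have pos: "1 + (tanh t)\<^sup>2 * (x j e * y j e) > 0" if "j < n" for j
    proof -
      have "x j e * y j e = 1 \<or> x j e * y j e = -1"
        using xy that e by (auto simp: sign_walk_def)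
      then show ?thesis using tanh1 by (elim disjE) (auto simp: add_pos_nonneg)
    qed
    have g: "?g e = exp (t * (?X e + ?Y e)) / (cosh t ^ (2 * n) * (\<Prod>j<n. 1 + (tanh t)\<^sup>2 * (x j e * y j e)))"
      by (simp add: prod_dividef prod.distrib exp_sum[symmetric] sum_distrib_left[symmetric]
          sum.distrib power_mult)
    have den_pos: "0 < cosh t ^ (2 * n) * (\<Prod>j<n. 1 + (tanh t)\<^sup>2 * (x j e * y j e))"
      using pos by (intro mult_pos_pos prod_pos) auto
    have g0: "0 \<le> ?g e"
      unfolding g using den_pos by simp
    show ?thesis
    proof (cases "b \<le> ?W e")
      case True
      then show ?thesis using g0 by (auto simp: C_def add_increasing2)
    next
      case W: False
      show ?thesis
      proof (cases "l \<le> ?X e \<and> l \<le> ?Y e")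
        case True
        have "(\<Prod>j<n. 1 + (tanh t)\<^sup>2 * (x j e * y j e)) \<le> (\<Prod>j<n. exp ((tanh t)\<^sup>2 * (x j e * y j e)))"
          by (intro prod_mono) (use pos in \<open>auto simp: less_imp_le\<close>)
        also have "\<dots> = exp ((tanh t)\<^sup>2 * ?W e)"
          by (simp add: exp_sum sum_distrib_left)
        also have "\<dots> \<le> exp (t\<^sup>2 * b)"
        proof -
          have "(tanh t)\<^sup>2 * ?W e \<le> (tanh t)\<^sup>2 * b"
            using W by (intro mult_left_mono) auto
          also have "\<dots> \<le> t\<^sup>2 * b"
            using tanh2 b by (rule mult_right_mono)
          finally show ?thesis by simp
        qed
        finally have "cosh t ^ (2 * n) * (\<Prod>j<n. 1 + (tanh t)\<^sup>2 * (x j e * y j e)) \<le> exp (n * t\<^sup>2) * exp (t\<^sup>2 * b)"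
          using cosh_power_le_exp[of t "2 * n"] pos
          by (intro mult_mono prod_nonneg) (auto simp: less_imp_le)
        then have "exp (t * (2 * l)) / (exp (n * t\<^sup>2) * exp (t\<^sup>2 * b)) \<le> ?g e"
          unfolding g using True t den_pos
          by (intro frac_le) (auto intro: mult_left_mono)
        then have "C * (exp (t * (2 * l)) / (exp (n * t\<^sup>2) * exp (t\<^sup>2 * b))) \<le> C * ?g e"
          by (intro mult_left_mono) (auto simp: C_def)
        moreover have "C * (exp (t * (2 * l)) / (exp (n * t\<^sup>2) * exp (t\<^sup>2 * b))) = 1"
          unfolding C_def by (simp add: mult_exp_exp exp_diff[symmetric] algebra_simps)
        ultimately have "1 \<le> C * ?g e" by linarith
        then show ?thesis using W True by simp
      qed (use g0 in \<open>auto simp: C_def\<close>)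
    qed
  qed
  have "avg I (\<lambda>e. of_bool (l \<le> ?X e \<and> l \<le> ?Y e)) \<le> avg I (\<lambda>e. of_bool (b \<le> ?W e) + C * ?g e)"
    by (rule avg_mono) (rule main)
  also have "\<dots> = avg I (\<lambda>e. of_bool (b \<le> ?W e)) + C"
    by (simp only: avg_add avg_cmult avg_pair_weight[OF I x y] mult_1_right)
  also have "avg I (\<lambda>e. of_bool (b \<le> ?W e)) \<le> exp (- b\<^sup>2 / (2 * real n))"
    by (rule sign_walk_upper_tail[OF I xy n b])
  finally show ?thesis
    by (simp add: C_def)
qed


section \<open>Pattern products and the upper bound\<close>

definition grid :: "nat \<Rightarrow> nat \<Rightarrow> (nat \<times> nat) set" where
  "grid N S = {1..N} \<times> {1..S}"

text \<open>The elements of a pattern F are pairs (lag, sequence).\<close>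

definition pat :: "(nat \<times> nat) set \<Rightarrow> nat \<Rightarrow> (nat \<times> nat \<Rightarrow> real) \<Rightarrow> real" where
  "pat F m e = (\<Prod>z\<in>F. e (m - fst z, snd z))"

lemma finite_grid [simp]: "finite (grid N S)"
  by (simp add: grid_def)

lemma card_grid: "card (grid N S) = N * S"
  by (simp add: grid_def)

lemma flip_apply: "flip i e j = (if j = i then - e j else e j)"
  by (simp add: flip_def)

lemma prod_signs:
  fixes f :: "'a \<Rightarrow> real"
  shows "(\<And>z. z \<in> F \<Longrightarrow> f z = 1 \<or> f z = -1) \<Longrightarrow> prod f F = 1 \<or> prod f F = -1"
proof (induction F rule: infinite_finite_induct)
  case (insert x F)
  then have "f x = 1 \<or> f x = -1" "prod f F = 1 \<or> prod f F = -1" by blast+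
  then show ?case using insert.hyps by auto
qed auto

lemma pat_sign:
  assumes "e \<in> sgns (grid N S)" "F \<subseteq> {0..L} \<times> {1..S}" "L < m" "m \<le> N"
  shows "pat F m e = 1 \<or> pat F m e = -1"
  unfolding pat_def
proof (rule prod_signs)
  fix z assume "z \<in> F"
  then have "(m - fst z, snd z) \<in> grid N S"
    using assms by (auto simp: grid_def)
  then show "e (m - fst z, snd z) = 1 \<or> e (m - fst z, snd z) = -1"
    by (rule sgns_cases[OF assms(1)])
qed

text \<open>Common factors square to 1, leaving the symmetric difference. Hence the product of two
  different patterns is again a nontrivial pattern, and its sums are again a walk.\<close>

lemma pat_mult:
  assumes "finite F" "finite G" and e: "e \<in> sgns (grid N S)"
    and F: "F \<subseteq> {0..L} \<times> {1..S}" and m: "L < m" "m \<le> N"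
  shows "pat F m e * pat G m e = pat ((F - G) \<union> (G - F)) m e"
proof -
  have 1: "pat F m e = pat (F \<inter> G) m e * pat (F - G) m e"
    unfolding pat_def by (rule prod.Int_Diff[OF assms(1)])
  have 2: "pat G m e = pat (F \<inter> G) m e * pat (G - F) m e"
    unfolding pat_def Int_commute[of F] by (rule prod.Int_Diff[OF assms(2)])
  have 3: "pat ((F - G) \<union> (G - F)) m e = pat (F - G) m e * pat (G - F) m e"
    unfolding pat_def by (rule prod.union_disjoint) (use assms in auto)
  have 4: "pat (F \<inter> G) m e * pat (F \<inter> G) m e = 1"
    using pat_sign[OF e le_infI1[OF F] m, of G] by auto
  have "pat F m e * pat G m e =
      (pat (F \<inter> G) m e * pat (F \<inter> G) m e) * (pat (F - G) m e * pat (G - F) m e)"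
    unfolding 1 2 by (simp only: mult_ac)
  then show ?thesis
    unfolding 3 4 by simp
qed

text \<open>The pivot of a step is its latest factor.\<close>

lemma sign_walk_pat:
  assumes F: "F \<subseteq> {0..L} \<times> {1..S}" "(a, s) \<in> F" "\<And>z. z \<in> F \<Longrightarrow> a \<le> fst z" and N: "L + n \<le> N"
  shows "sign_walk (grid N S) n (\<lambda>j. (L + 1 + j - a, s)) (\<lambda>j. pat F (L + 1 + j))"
  unfolding sign_walk_def
proof (intro allI impI conjI ballI)
  have finF: "finite F" using F(1) finite_subset by blast
  fix j assume j: "j < n"
  show "(L + 1 + j - a, s) \<in> grid N S"
    using F j N by (force simp: grid_def)
  fix e assume e: "e \<in> sgns (grid N S)"
  show "pat F (L + 1 + j) e = 1 \<or> pat F (L + 1 + j) e = - 1"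
    by (rule pat_sign[OF e F(1)]) (use j N in auto)
  show "pat F (L + 1 + j) (flip (L + 1 + j - a, s) e) = - pat F (L + 1 + j) e"
  proof -
    \<comment> \<open>All lags are at most L, so the subtractions are not truncated and different
      pattern elements read different variables: the pivot occurs exactly once.\<close>
    have "(L + 1 + j - fst z, snd z) \<noteq> (L + 1 + j - a, s)" if z: "z \<in> F - {(a, s)}" for z
    proof
      assume eq: "(L + 1 + j - fst z, snd z) = (L + 1 + j - a, s)"
      have "fst z \<le> L" "a \<le> L" using F z by auto
      with eq have "z = (a, s)" by (auto simp: prod_eq_iff)
      with z show False by simp
    qed
    then have "(\<Prod>z\<in>F - {(a, s)}. flip (L + 1 + j - a, s) e (L + 1 + j - fst z, snd z)) =
        (\<Prod>z\<in>F - {(a, s)}. e (L + 1 + j - fst z, snd z))"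
      by (intro prod.cong) (auto simp: flip_apply)
    then show ?thesis
      unfolding pat_def prod.remove[OF finF F(2)] by (simp add: flip_apply)
  qed
  fix i assume i: "i < j"
  \<comment> \<open>Since a is the least lag, step i < j reads only variables at times before the
    pivot's time.\<close>
  have "(L + 1 + i - fst z, snd z) \<noteq> (L + 1 + j - a, s)" if z: "z \<in> F" for z
    using F(1) F(3)[OF z] z i by auto
  then show "pat F (L + 1 + i) (flip (L + 1 + j - a, s) e) = pat F (L + 1 + i) e"
    unfolding pat_def by (intro prod.cong) (auto simp: flip_apply)
qed

lemma sign_walk_pat_ex:
  assumes F: "F \<subseteq> {0..L} \<times> {1..S}" "F \<noteq> {}" and N: "L + n \<le> N"
  shows "\<exists>p. sign_walk (grid N S) n p (\<lambda>j. pat F (L + 1 + j))"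
proof -
  have fin: "finite F" using F(1) finite_subset by blast
  have "Min (fst ` F) \<in> fst ` F" using fin F by (intro Min_in) auto
  then obtain a s where as: "(a, s) \<in> F" "a = Min (fst ` F)" by auto
  have "a \<le> fst z" if "z \<in> F" for z
    using as(2) fin that by simp
  then show ?thesis
    using sign_walk_pat[OF F(1) as(1) _ N] by blast
qed

section \<open>The cross-correlation measure as a maximum over a finite set\<close>

lemma finite_corr_values:
  assumes "k \<ge> 1"
  shows "finite {\<bar>corr_sum e k M d s\<bar> | M d s. admissible N S k M d s}"
proof -
  \<comment> \<open>Both \<open>d\<close> and \<open>s\<close> vanish outside {1..k} by
    \<open>admissible\<close>, so they range over a finite set; N + S bounds shifts and sequence
    indices alike.\<close>
  let ?A = "{f :: nat \<Rightarrow> nat. \<forall>i. (i \<in> {1..k} \<longrightarrow> f i \<in> {0..N + S}) \<and> (i \<notin> {1..k} \<longrightarrow> f i = 0)}"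
  have fin: "finite ?A" by (rule finite_set_of_finite_funs) auto
  have "{\<bar>corr_sum e k M d s\<bar> | M d s. admissible N S k M d s}
      \<subseteq> (\<lambda>(M, d, s). \<bar>corr_sum e k M d s\<bar>) ` ({0..N} \<times> ?A \<times> ?A)"
  proof clarify
    fix M d s assume a: "admissible N S k M d s"
    have "d i \<le> N + S" if "i \<in> {1..k}" for i
    proof -
      have "d i \<le> d k" using a that assms unfolding admissible_def by auto
      then show ?thesis using a unfolding admissible_def by auto
    qed
    moreover have "s i \<le> N + S" if "i \<in> {1..k}" for i
      using a that unfolding admissible_def by (meson trans_le_add2)
    ultimately have "(M, d, s) \<in> {0..N} \<times> ?A \<times> ?A"
      using a unfolding admissible_def by auto
    then show "\<bar>corr_sum e k M d s\<bar> \<in> (\<lambda>(M, d, s). \<bar>corr_sum e k M d s\<bar>) ` ({0..N} \<times> ?A \<times> ?A)"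
      by (rule rev_image_eqI) simp
  qed
  then show ?thesis
    by (rule finite_subset) (use fin in auto)
qed

lemma admissible_ex:
  assumes "1 \<le> k" "k \<le> N" "1 \<le> S"
  shows "\<exists>M d s. admissible N S k M d s"
proof -
  have "admissible N S k 1 (\<lambda>i. if i \<in> {1..k} then i - 1 else 0) (\<lambda>i. if i \<in> {1..k} then 1 else 0)"
    using assms by (auto simp: admissible_def)
  then show ?thesis by blast
qed

lemma cross_corr_ge:
  assumes "k \<ge> 1" "admissible N S k M d s"
  shows "\<bar>corr_sum e k M d s\<bar> \<le> cross_corr k e N S"
  unfolding cross_corr_def using assms(2) by (intro Max_ge[OF finite_corr_values[OF assms(1)]]) blast

lemma cross_corr_attained:
  assumes "1 \<le> k" "k \<le> N" "1 \<le> S"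
  shows "\<exists>M d s. admissible N S k M d s \<and> cross_corr k e N S = \<bar>corr_sum e k M d s\<bar>"
proof -
  have "cross_corr k e N S \<in> {\<bar>corr_sum e k M d s\<bar> | M d s. admissible N S k M d s}"
    unfolding cross_corr_def
    by (rule Max_in[OF finite_corr_values]) (use assms admissible_ex[OF assms] in auto)
  then show ?thesis by blast
qed

text \<open>Enlarging N only adds admissible triples. This monotonicity later fills the gaps between
  the powers j^m.\<close>

lemma cross_corr_mono:
  assumes "1 \<le> k" "k \<le> N" "1 \<le> S" "N \<le> N'"
  shows "cross_corr k e N S \<le> cross_corr k e N' S"
proof -
  obtain M d s where a: "admissible N S k M d s" "cross_corr k e N S = \<bar>corr_sum e k M d s\<bar>"
    using cross_corr_attained[OF assms(1-3)] by blast
  have "admissible N' S k M d s" using a(1) assms(4) by (auto simp: admissible_def)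
  then show ?thesis using a(2) cross_corr_ge assms by simp
qed

lemma corr_sum_cong:
  assumes k: "k \<ge> 1" and adm: "admissible N S k M d s" and ef: "\<And>i. i \<in> grid N S \<Longrightarrow> e i = f i"
  shows "corr_sum (\<lambda>n s. e (n, s)) k M d s = corr_sum (\<lambda>n s. f (n, s)) k M d s"
  unfolding corr_sum_def
proof (intro sum.cong prod.cong refl ef)
  fix n i assume n: "n \<in> {1..M}" and i: "i \<in> {1..k}"
  then have "d i \<le> d k" "s i \<in> {1..S}" "M + d k \<le> N" using adm k unfolding admissible_def by auto
  then show "(n + d i, s i) \<in> grid N S"
    using n by (auto simp: grid_def)
qed

lemma cross_corr_cong:
  assumes "k \<ge> 1" and "\<And>i. i \<in> grid N S \<Longrightarrow> e i = f i"
  shows "cross_corr k (\<lambda>n s. e (n, s)) N S = cross_corr k (\<lambda>n s. f (n, s)) N S"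
proof -
  have eq: "corr_sum (\<lambda>n s. e (n, s)) k M d s = corr_sum (\<lambda>n s. f (n, s)) k M d s"
    if "admissible N S k M d s" for M d s
    using assms that by (intro corr_sum_cong) auto
  have "(\<exists>M d s. x = \<bar>corr_sum (\<lambda>n s. e (n, s)) k M d s\<bar> \<and> admissible N S k M d s) \<longleftrightarrow>
      (\<exists>M d s. x = \<bar>corr_sum (\<lambda>n s. f (n, s)) k M d s\<bar> \<and> admissible N S k M d s)" for x
    by (intro ex_cong1) (use eq in auto)
  then show ?thesis unfolding cross_corr_def by simp
qed

text \<open>Lags are counted backwards from the latest factor, which gets lag 0. The sum then
  becomes the increment of one walk, determined by the lags alone, between the times d 1 and d 1 + M
  (via j = n + d 1 - 1). So a common translation of the shifts only moves the increment, and k - 1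
  lags remain free.\<close>

lemma corr_sum_eq_pat:
  assumes k: "k \<ge> 1" and adm: "admissible N S k M d s"
  defines "F \<equiv> (\<lambda>i. (d k - d i, s i)) ` {1..k}"
  shows "corr_sum (\<lambda>n s. e (n, s)) k M d s = (\<Sum>j=d 1..<d 1 + M. pat F ((d k - d 1) + 1 + j) e)"
    and "card F = k" and "F \<subseteq> {0..d k - d 1} \<times> {1..S}" and "(0, s k) \<in> F" and "d k < N"
    and "d 1 + M \<le> N - (d k - d 1)"
proof -
  have le: "d i \<le> d k" "d 1 \<le> d i" if "i \<in> {1..k}" for i
    using adm that k unfolding admissible_def by auto
  have inj: "inj_on (\<lambda>i. (d k - d i, s i)) {1..k}"
  proof (rule inj_onI)
    fix i j assume i: "i \<in> {1..k}" and j: "j \<in> {1..k}" and eq: "(d k - d i, s i) = (d k - d j, s j)"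
    have "d i = d j" "s i = s j" using eq le[OF i] le[OF j] by auto
    then show "i = j" using adm i j unfolding admissible_def by blast
  qed
  show "card F = k"
    unfolding F_def card_image[OF inj] by simp
  show "F \<subseteq> {0..d k - d 1} \<times> {1..S}"
    using adm k le unfolding F_def admissible_def by (auto simp: diff_le_mono2)
  show "(0, s k) \<in> F"
    unfolding F_def using k by force
  show "d k < N" "d 1 + M \<le> N - (d k - d 1)"
    using adm le[of k] k unfolding admissible_def by auto
  have "corr_sum (\<lambda>n s. e (n, s)) k M d s = (\<Sum>n = 1..M. pat F (n + d k) e)"
    unfolding corr_sum_def pat_def F_def prod.reindex[OF inj] o_def
    by (intro sum.cong prod.cong refl) (use le in \<open>auto simp: add.commute\<close>)
  also have "\<dots> = (\<Sum>j=d 1..<d 1 + M. pat F ((d k - d 1) + 1 + j) e)"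
    by (rule sum.reindex_bij_witness[of _ "\<lambda>j. j + 1 - d 1" "\<lambda>n. n + d 1 - 1"])
      (use le[of 1] k in \<open>auto simp: add.commute\<close>)
  finally show "corr_sum (\<lambda>n s. e (n, s)) k M d s = (\<Sum>j=d 1..<d 1 + M. pat F ((d k - d 1) + 1 + j) e)" .
qed

text \<open>Requiring an element of lag 0 removes the translation, so that the count has order
  N^(k-1) instead of N^k.\<close>

definition pats :: "nat \<Rightarrow> nat \<Rightarrow> nat \<Rightarrow> (nat \<times> nat) set set" where
  "pats N S k = {F. F \<subseteq> {0..<N} \<times> {1..S} \<and> card F = k \<and> (\<exists>s. (0, s) \<in> F)}"

lemma finite_pats [simp]: "finite (pats N S k)"
  by (rule finite_subset[of _ "Pow ({0..<N} \<times> {1..S})"]) (auto simp: pats_def)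

lemma card_pats_le:
  assumes k: "k \<ge> 1" and N: "N \<ge> k" and S: "S \<ge> 1"
  shows "card (pats N S k) \<le> S * (N * S) ^ (k - 1)"
proof -
  let ?B = "{0..<N} \<times> {1..S}"
  let ?G = "{G. G \<subseteq> ?B \<and> card G = k - 1}"
  have sub: "pats N S k \<subseteq> (\<lambda>(s, G). insert (0, s) G) ` ({1..S} \<times> ?G)"
  proof
    fix F assume F: "F \<in> pats N S k"
    then obtain s where s: "(0, s) \<in> F" by (auto simp: pats_def)
    have "F - {(0, s)} \<in> ?G" "s \<in> {1..S}"
      using F s by (auto simp: pats_def)
    then show "F \<in> (\<lambda>(s, G). insert (0, s) G) ` ({1..S} \<times> ?G)"
      using s by (intro rev_image_eqI[of "(s, F - {(0, s)})"]) auto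
  qed
  have finG: "finite ?G" by (rule finite_subset[of _ "Pow ?B"]) auto
  have "card (pats N S k) \<le> card ({1..S} \<times> ?G)"
    using finG by (intro surj_card_le[OF _ sub]) auto
  also have "\<dots> = S * (N * S choose (k - 1))"
    by (simp add: card_cartesian_product n_subsets)
  also have "\<dots> \<le> S * (N * S) ^ (k - 1)"
  proof -
    have "k - 1 \<le> N * S" using N S by (metis diff_le_self le_trans mult.right_neutral mult_le_mono2)
    then show ?thesis by (intro mult_left_mono binomial_le_pow) auto
  qed
  finally show ?thesis .
qed

lemma avg_cross_corr_upper_tail:
  assumes k: "k \<ge> 1" and N: "N \<ge> k" and S: "S \<ge> 1" and l: "l > 0"
  shows "avg (grid N S) (\<lambda>e. of_bool (l \<le> cross_corr k (\<lambda>n s. e (n, s)) N S))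
           \<le> real (S * (N * S) ^ (k - 1)) * (4 * exp (- l\<^sup>2 / (2 * real N)))"
proof -
  define L where "L F = Max (fst ` F)" for F :: "(nat \<times> nat) set"
  let ?P = "\<lambda>F e. \<exists>u v. u \<le> v \<and> v \<le> N - L F \<and> l \<le> \<bar>\<Sum>j=u..<v. pat F (L F + 1 + j) e\<bar>"
  have "avg (grid N S) (\<lambda>e. of_bool (l \<le> cross_corr k (\<lambda>n s. e (n, s)) N S))
      \<le> avg (grid N S) (\<lambda>e. \<Sum>F\<in>pats N S k. of_bool (?P F e))"
  proof (rule avg_mono)
    fix e
    show "of_bool (l \<le> cross_corr k (\<lambda>n s. e (n, s)) N S) \<le> (\<Sum>F\<in>pats N S k. of_bool (?P F e) :: real)"
    proof (cases "l \<le> cross_corr k (\<lambda>n s. e (n, s)) N S")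
      case True
      then obtain M d s where adm: "admissible N S k M d s"
        and l': "l \<le> \<bar>corr_sum (\<lambda>n s. e (n, s)) k M d s\<bar>"
        using cross_corr_attained[OF k N S, of "\<lambda>n s. e (n, s)"] by auto
      define F where "F = (\<lambda>i. (d k - d i, s i)) ` {1..k}"
      note F = corr_sum_eq_pat[OF k adm, folded F_def]
      have Fp: "F \<in> pats N S k"
        using F(2-5) unfolding pats_def by force
      \<comment> \<open>The walk in \<open>?P\<close> must depend on F only, so the largest lag is
        recovered from the pattern.\<close>
      have "L F = d k - d 1"
        unfolding L_def
      proof (rule Max_eqI)
        show "finite (fst ` F)" by (simp add: F_def)
        show "y \<le> d k - d 1" if "y \<in> fst ` F" for y using F(3) that by auto
        show "d k - d 1 \<in> fst ` F" unfolding F_def using k by (force simp: image_iff)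
      qed
      then have "?P F e"
        using l' F(1)[of e] F(6) by (intro exI[of _ "d 1"] exI[of _ "d 1 + M"]) simp
      then have "(1::real) = of_bool (?P F e)" by simp
      also have "\<dots> \<le> (\<Sum>F\<in>pats N S k. of_bool (?P F e))"
        by (rule member_le_sum[OF Fp]) auto
      finally show ?thesis using True by simp
    qed (simp add: sum_nonneg)
  qed
  also have "\<dots> = (\<Sum>F\<in>pats N S k. avg (grid N S) (\<lambda>e. of_bool (?P F e)))"
    by (rule avg_sum)
  also have "\<dots> \<le> (\<Sum>F\<in>pats N S k. 4 * exp (- l\<^sup>2 / (2 * real N)))"
  proof (rule sum_mono)
    fix F assume F: "F \<in> pats N S k"
    then have fin: "finite F" using finite_subset unfolding pats_def by blast
    have "F \<noteq> {}" using F by (auto simp: pats_def)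
    then have "L F \<in> fst ` F" unfolding L_def using fin by (intro Max_in) auto
    then have "L F < N" using F by (auto simp: pats_def)
    have "F \<subseteq> {0..L F} \<times> {1..S}"
    proof
      fix z assume z: "z \<in> F"
      then have "fst z \<le> L F" unfolding L_def using fin by simp
      then show "z \<in> {0..L F} \<times> {1..S}" using F z by (cases z) (auto simp: pats_def)
    qed
    from sign_walk_pat_ex[OF this \<open>F \<noteq> {}\<close>, of "N - L F" N] \<open>L F < N\<close>
    obtain p where "sign_walk (grid N S) (N - L F) p (\<lambda>j. pat F (L F + 1 + j))" by auto
    then show "avg (grid N S) (\<lambda>e. of_bool (?P F e)) \<le> 4 * exp (- l\<^sup>2 / (2 * real N))"
      by (rule sign_walk_abs_increment_tail[OF finite_grid]) (use N k l in auto)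
  qed
  also have "\<dots> = real (card (pats N S k)) * (4 * exp (- l\<^sup>2 / (2 * real N)))"
    by simp
  also have "\<dots> \<le> real (S * (N * S) ^ (k - 1)) * (4 * exp (- l\<^sup>2 / (2 * real N)))"
    by (intro mult_right_mono of_nat_mono card_pats_le k N S) auto
  finally show ?thesis .
qed


section \<open>The lower bound\<close>

text \<open>Cauchy-Schwarz for the number K of events that occur: (E K)^2 <= E K^2 * P(K > 0).
  \<open>Q\<close> measures the failure of pairwise independence and may be large, which is why only
  1 / (4 + Q) results.\<close>

lemma avg_second_moment:
  fixes Q q :: real
  assumes I: "finite I" and T: "finite T" and q: "q > 0" and Q: "Q \<ge> 0"
    and one: "\<And>a. a \<in> T \<Longrightarrow> q \<le> avg I (\<lambda>e. of_bool (P a e))"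
    and two: "\<And>a b. a \<in> T \<Longrightarrow> b \<in> T \<Longrightarrow> a \<noteq> b \<Longrightarrow> avg I (\<lambda>e. of_bool (P a e \<and> P b e)) \<le> Q * q\<^sup>2"
    and big: "1 / 4 \<le> card T * q"
  shows "1 / (4 + Q) \<le> avg I (\<lambda>e. of_bool (\<exists>a\<in>T. P a e))"
proof -
  define K where "K e = (\<Sum>a\<in>T. of_bool (P a e) :: real)" for e
  define H where "H e = (of_bool (\<exists>a\<in>T. P a e) :: real)" for e
  define \<mu> where "\<mu> = avg I K"
  have \<mu>_sum: "\<mu> = (\<Sum>a\<in>T. avg I (\<lambda>e. of_bool (P a e)))"
    unfolding \<mu>_def K_def by (rule avg_sum)
  have "card T * q \<le> \<mu>"
    unfolding \<mu>_sum using one by (intro sum_bounded_below) auto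
  with big have \<mu>: "card T * q \<le> \<mu>" "1 / 4 \<le> \<mu>" by auto
  have "avg I (\<lambda>e. (K e)\<^sup>2) = avg I (\<lambda>e. \<Sum>a\<in>T. \<Sum>b\<in>T. of_bool (P a e \<and> P b e))"
    by (rule avg_cong) (simp add: K_def power2_eq_square sum_product of_bool_conj)
  also have "\<dots> = (\<Sum>a\<in>T. \<Sum>b\<in>T. avg I (\<lambda>e. of_bool (P a e \<and> P b e)))"
    by (simp only: avg_sum)
  also have "\<dots> \<le> (\<Sum>a\<in>T. \<Sum>b\<in>T. (if b = a then avg I (\<lambda>e. of_bool (P a e)) else 0) + Q * q\<^sup>2)"
    using two Q by (intro sum_mono) (auto simp: add_increasing2)
  also have "\<dots> = \<mu> + Q * (card T * q)\<^sup>2"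
    using T by (simp add: \<mu>_sum sum.distrib sum.delta' power2_eq_square algebra_simps)
  \<comment> \<open>The diagonal contributes the mean itself, absorbed into its square because the
    mean is at least 1/4.\<close>
  also have "\<dots> \<le> 4 * \<mu> * \<mu> + Q * \<mu>\<^sup>2"
  proof (rule add_mono)
    show "\<mu> \<le> 4 * \<mu> * \<mu>" using mult_right_mono[of 1 "4 * \<mu>" \<mu>] \<mu>(2) by simp
    show "Q * (card T * q)\<^sup>2 \<le> Q * \<mu>\<^sup>2" using \<mu> q Q by (intro mult_left_mono power_mono) auto
  qed
  finally have K2: "avg I (\<lambda>e. (K e)\<^sup>2) \<le> (4 + Q) * \<mu>\<^sup>2"
    by (simp add: power2_eq_square algebra_simps)
  have "\<mu> = avg I (\<lambda>e. K e * H e)"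
    unfolding \<mu>_def by (rule avg_cong) (auto simp: K_def H_def intro!: sum.neutral)
  then have "\<mu>\<^sup>2 = (\<Sum>e\<in>sgns I. K e * H e)\<^sup>2 / (2 ^ card I)\<^sup>2"
    by (simp add: avg_def power_divide)
  also have "\<dots> \<le> ((\<Sum>e\<in>sgns I. (K e)\<^sup>2) * (\<Sum>e\<in>sgns I. (H e)\<^sup>2)) / (2 ^ card I)\<^sup>2"
    by (intro divide_right_mono Cauchy_Schwarz_ineq_sum) auto
  also have "\<dots> = avg I (\<lambda>e. (K e)\<^sup>2) * avg I (\<lambda>e. (H e)\<^sup>2)"
    by (simp add: avg_def power2_eq_square)
  also have "(\<lambda>e. (H e)\<^sup>2) = H"
    by (auto simp: H_def)
  also have "avg I (\<lambda>e. (K e)\<^sup>2) * avg I H \<le> ((4 + Q) * \<mu>\<^sup>2) * avg I H"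
    by (intro mult_right_mono K2 avg_nonneg) (simp add: H_def)
  finally have "\<mu>\<^sup>2 * 1 \<le> \<mu>\<^sup>2 * ((4 + Q) * avg I H)"
    by (simp add: algebra_simps)
  then have "1 \<le> (4 + Q) * avg I H"
    using \<mu>(2) by (simp only: mult_le_cancel_left_pos zero_less_power)
  then show ?thesis
    using Q unfolding H_def by (simp add: field_simps)
qed

text \<open>The common lag 0 makes all these walks share their pivots.\<close>

definition lag_pat :: "nat set \<Rightarrow> (nat \<times> nat) set" where
  "lag_pat A = insert 0 A \<times> {1}"

definition lag_sum :: "nat \<Rightarrow> nat \<Rightarrow> nat set \<Rightarrow> (nat \<times> nat \<Rightarrow> real) \<Rightarrow> real" where
  "lag_sum L n A e = (\<Sum>j<n. pat (lag_pat A) (L + 1 + j) e)"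

definition lag_sets :: "nat \<Rightarrow> nat \<Rightarrow> nat set set" where
  "lag_sets L k = {A. A \<subseteq> {1..L} \<and> card A = k - 1}"

lemma finite_lag_sets [simp]: "finite (lag_sets L k)"
  by (rule finite_subset[of _ "Pow {1..L}"]) (auto simp: lag_sets_def)

lemma card_lag_sets: "card (lag_sets L k) = L choose (k - 1)"
  using n_subsets[of "{1..L}" "k - 1"] by (simp add: lag_sets_def)

lemma lag_pat_subset: "A \<in> lag_sets L k \<Longrightarrow> S \<ge> 1 \<Longrightarrow> lag_pat A \<subseteq> {0..L} \<times> {1..S}"
  by (auto simp: lag_pat_def lag_sets_def)

lemma finite_lag_pat: "A \<in> lag_sets L k \<Longrightarrow> finite (lag_pat A)"
  using finite_subset[of A "{1..L}"] by (auto simp: lag_pat_def lag_sets_def)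

lemma card_lag_pat: "A \<in> lag_sets L k \<Longrightarrow> k \<ge> 1 \<Longrightarrow> card (lag_pat A) = k"
proof -
  assume A: "A \<in> lag_sets L k" and k: "k \<ge> 1"
  then have "finite A" "0 \<notin> A" using finite_subset[of A "{1..L}"] by (auto simp: lag_sets_def)
  then show ?thesis
    using A k by (simp add: lag_pat_def lag_sets_def card_cartesian_product)
qed

text \<open>The full walk of N - L steps is one admissible correlation sum, with all indices in
  sequence 1 and M = N - L.\<close>

lemma lag_sum_le_cross_corr:
  assumes A: "A \<in> lag_sets L k" and k: "k \<ge> 1" and L: "L < N" and S: "S \<ge> 1"
  shows "lag_sum L (N - L) A e \<le> cross_corr k (\<lambda>n s. e (n, s)) N S"
proof -
  have fin: "finite A" and A0: "0 \<notin> A" and AL: "A \<subseteq> {1..L}"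
    using A finite_subset[of A "{1..L}"] by (auto simp: lag_sets_def)
  define l where "l = sorted_list_of_set (insert 0 A)"
  have set_l: "set l = insert 0 A"
    unfolding l_def by (rule set_sorted_list_of_set) (use fin in simp)
  have sorted: "sorted l" and dist: "distinct l"
    unfolding l_def by (rule sorted_sorted_list_of_set distinct_sorted_list_of_set)+
  have len: "length l = k"
    using distinct_card[OF dist] fin A0 A k by (simp add: set_l lag_sets_def)
  have lL: "l ! i \<le> L" if "i < k" for i
    using nth_mem[of i l] that AL unfolding set_l len by auto
  have l0: "l ! 0 = 0"
  proof -
    obtain i where "i < k" "l ! i = 0"
      using set_l len by (metis in_set_conv_nth insertI1)
    then show ?thesis using sorted_nth_mono[OF sorted, of 0 i] len by simp
  qed
  \<comment> \<open>Increasing shifts correspond to decreasing lags, hence the list is read from its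
    end; its first entry, lag 0, gives d k = L.\<close>
  define d where "d i = (if i \<in> {1..k} then L - l ! (k - i) else 0)" for i
  define s where "s i = (if i \<in> {1..k} then 1 else 0::nat)" for i
  have dk: "d k = L" using k l0 by (simp add: d_def)
  have adm: "admissible N S k (N - L) d s"
    unfolding admissible_def
  proof (intro conjI ballI impI allI)
    fix i j assume i: "i \<in> {1..k}" and j: "j \<in> {1..k}"
    {
      assume "i \<le> j"
      then have "l ! (k - j) \<le> l ! (k - i)"
        using i j len by (intro sorted_nth_mono[OF sorted]) auto
      then show "d i \<le> d j" using i j by (simp add: d_def)
    }
    assume "i \<noteq> j \<and> s i = s j"
    then have "l ! (k - i) \<noteq> l ! (k - j)"
      using i j len dist by (subst nth_eq_iff_index_eq) auto
    moreover have "l ! (k - i) \<le> L" "l ! (k - j) \<le> L" using lL i j by auto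
    ultimately show "d i \<noteq> d j" using i j by (auto simp: d_def)
  qed (use L S dk in \<open>auto simp: d_def s_def\<close>)
  define F where "F = (\<lambda>i. (d k - d i, s i)) ` {1..k}"
  have "F = (\<lambda>i. (l ! (k - i), 1)) ` {1..k}"
    unfolding F_def dk by (intro image_cong) (use lL in \<open>auto simp: d_def s_def\<close>)
  also have "\<dots> = (\<lambda>i. (l ! i, 1)) ` {..<k}"
  proof (intro equalityI subsetI)
    fix z assume "z \<in> (\<lambda>i. (l ! (k - i), 1::nat)) ` {1..k}"
    then obtain i where "i \<in> {1..k}" "z = (l ! (k - i), 1)" by blast
    then show "z \<in> (\<lambda>i. (l ! i, 1)) ` {..<k}" by (intro rev_image_eqI[of "k - i"]) auto
  next
    fix z assume "z \<in> (\<lambda>i. (l ! i, 1::nat)) ` {..<k}"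
    then obtain i where "i < k" "z = (l ! i, 1)" by blast
    then show "z \<in> (\<lambda>i. (l ! (k - i), 1)) ` {1..k}" by (intro rev_image_eqI[of "k - i"]) auto
  qed
  also have "\<dots> = set l \<times> {1}"
    unfolding set_conv_nth len by auto
  also have "\<dots> = lag_pat A"
    by (simp add: set_l lag_pat_def)
  finally have F: "F = lag_pat A" .
  have "corr_sum (\<lambda>n s. e (n, s)) k (N - L) d s = (\<Sum>j=d 1..<d 1 + (N - L). pat F ((d k - d 1) + 1 + j) e)"
    unfolding F_def by (rule corr_sum_eq_pat(1)[OF k adm])
  also have "\<dots> = lag_sum L (N - L) A e"
  proof -
    have "d 1 \<le> L" by (simp add: d_def)
    then show ?thesis
      unfolding lag_sum_def F dk
      by (intro sum.reindex_bij_witness[of _ "\<lambda>j. j + d 1" "\<lambda>j. j - d 1"]) auto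
  qed
  finally show ?thesis
    using cross_corr_ge[OF k adm, of "\<lambda>n s. e (n, s)"] by linarith
qed

lemma lag_walk:
  assumes "A \<in> lag_sets L k" "S \<ge> 1" "L < N"
  shows "sign_walk (grid N S) (N - L) (\<lambda>j. (L + 1 + j - 0, 1)) (\<lambda>j. pat (lag_pat A) (L + 1 + j))"
  by (rule sign_walk_pat) (use assms lag_pat_subset[OF assms(1,2)] in \<open>auto simp: lag_pat_def\<close>)

text \<open>The product is the pattern of the symmetric difference, nonempty because A and B differ
  and neither contains 0. The common lag 0 cancels in it, so its pivots are new. The identity holds
  only on sign vectors and for j < N - L, hence the walk property is checked clause by
  clause.\<close>

lemma lag_walk_mult:
  assumes A: "A \<in> lag_sets L k" and B: "B \<in> lag_sets L k" and S: "S \<ge> 1" and L: "L < N" and AB: "A \<noteq> B"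
  shows "\<exists>q. sign_walk (grid N S) (N - L) q
    (\<lambda>j e. pat (lag_pat A) (L + 1 + j) e * pat (lag_pat B) (L + 1 + j) e)"
proof -
  let ?D = "(lag_pat A - lag_pat B) \<union> (lag_pat B - lag_pat A)"
  have "0 \<notin> A" "0 \<notin> B" using A B by (auto simp: lag_sets_def)
  then have "insert 0 A \<noteq> insert 0 B" using AB by (metis insert_ident)
  then have "lag_pat A \<noteq> lag_pat B"
    unfolding lag_pat_def times_eq_iff by blast
  then have ne: "?D \<noteq> {}" by blast
  have sub: "?D \<subseteq> {0..L} \<times> {1..S}"
    using lag_pat_subset[OF A S] lag_pat_subset[OF B S] by blast
  obtain q where q: "sign_walk (grid N S) (N - L) q (\<lambda>j. pat ?D (L + 1 + j))"
    using sign_walk_pat_ex[OF sub ne, of "N - L" N] L by auto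
  have eq: "pat (lag_pat A) (L + 1 + j) e * pat (lag_pat B) (L + 1 + j) e = pat ?D (L + 1 + j) e"
    if "e \<in> sgns (grid N S)" "j < N - L" for e j
    by (rule pat_mult[OF finite_lag_pat[OF A] finite_lag_pat[OF B] that(1) lag_pat_subset[OF A S]])
      (use that in auto)
  have "sign_walk (grid N S) (N - L) q
    (\<lambda>j e. pat (lag_pat A) (L + 1 + j) e * pat (lag_pat B) (L + 1 + j) e)"
    unfolding sign_walk_def
  proof (intro allI impI conjI ballI)
    fix j assume j: "j < N - L"
    show qj: "q j \<in> grid N S" using q j by (auto simp: sign_walk_def)
    fix e assume e: "e \<in> sgns (grid N S)"
    note fe = flip_in_sgns[OF qj e]
    show "pat (lag_pat A) (L + 1 + j) e * pat (lag_pat B) (L + 1 + j) e = 1 \<or>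
        pat (lag_pat A) (L + 1 + j) e * pat (lag_pat B) (L + 1 + j) e = - 1"
      unfolding eq[OF e j] using q j e by (simp add: sign_walk_def)
    show "pat (lag_pat A) (L + 1 + j) (flip (q j) e) * pat (lag_pat B) (L + 1 + j) (flip (q j) e) =
        - (pat (lag_pat A) (L + 1 + j) e * pat (lag_pat B) (L + 1 + j) e)"
      unfolding eq[OF e j] eq[OF fe j] using q j e by (simp add: sign_walk_def)
    fix i assume i: "i < j"
    then have iN: "i < N - L" using j by simp
    show "pat (lag_pat A) (L + 1 + i) (flip (q j) e) * pat (lag_pat B) (L + 1 + i) (flip (q j) e) =
        pat (lag_pat A) (L + 1 + i) e * pat (lag_pat B) (L + 1 + i) e"
      unfolding eq[OF e iN] eq[OF fe iN] using q j e i by (simp add: sign_walk_def)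
  qed
  then show ?thesis by blast
qed

text \<open>A variable enters at most one step per pattern element, hence at most k steps, and each
  of these changes by at most 2.\<close>

lemma lag_sum_bounded_differences:
  assumes A: "A \<in> lag_sets L k" and k: "k \<ge> 1" and S: "S \<ge> 1" and L: "L < N"
    and i: "i \<in> grid N S" and e: "e \<in> sgns (grid N S)"
  shows "\<bar>lag_sum L (N - L) A (flip i e) - lag_sum L (N - L) A e\<bar> \<le> 2 * real k"
proof -
  let ?F = "lag_pat A"
  let ?x = "\<lambda>j e. pat ?F (L + 1 + j) e"
  let ?J = "{j \<in> {..<N - L}. \<exists>z\<in>?F. (L + 1 + j - fst z, snd z) = i}"
  have ch: "\<bar>?x j (flip i e) - ?x j e\<bar> \<le> 2 * of_bool (j \<in> ?J)" if j: "j < N - L" for j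
  proof (cases "j \<in> ?J")
    case True
    have jN: "L < L + 1 + j" "L + 1 + j \<le> N" using j by auto
    show ?thesis
      using pat_sign[OF e lag_pat_subset[OF A S] jN]
        pat_sign[OF flip_in_sgns[OF i e] lag_pat_subset[OF A S] jN] True by auto
  next
    case False
    then have "(L + 1 + j - fst z, snd z) \<noteq> i" if "z \<in> ?F" for z
      using j that by blast
    then have "?x j (flip i e) = ?x j e"
      unfolding pat_def by (intro prod.cong) (auto simp: flip_apply)
    then show ?thesis by simp
  qed
  have "\<bar>lag_sum L (N - L) A (flip i e) - lag_sum L (N - L) A e\<bar> = \<bar>\<Sum>j<N - L. ?x j (flip i e) - ?x j e\<bar>"
    by (simp add: lag_sum_def sum_subtractf)
  also have "\<dots> \<le> (\<Sum>j<N - L. \<bar>?x j (flip i e) - ?x j e\<bar>)"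
    by (rule sum_abs)
  also have "\<dots> \<le> (\<Sum>j<N - L. 2 * of_bool (j \<in> ?J))"
    using ch by (intro sum_mono) auto
  also have "\<dots> = 2 * real (card ?J)"
  proof -
    have "(\<Sum>j<N - L. of_bool (j \<in> ?J) :: real) = (\<Sum>j\<in>?J. 1)"
      by (intro sum.mono_neutral_cong_right) auto
    then show ?thesis by (simp add: sum_distrib_left[symmetric])
  qed
  also have "card ?J \<le> card ?F"
  proof -
    have "?J \<subseteq> (\<lambda>z. fst i + fst z - L - 1) ` ?F"
    proof
      fix j assume "j \<in> ?J"
      then obtain z where z: "z \<in> ?F" "(L + 1 + j - fst z, snd z) = i" by auto
      then have "fst z \<le> L" using lag_pat_subset[OF A S] by auto
      then have "j = fst i + fst z - L - 1" using z(2) by auto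
      then show "j \<in> (\<lambda>z. fst i + fst z - L - 1) ` ?F" using z(1) by blast
    qed
    then show ?thesis using finite_lag_pat[OF A] by (meson surj_card_le)
  qed
  also have "card ?F = k" by (rule card_lag_pat[OF A k])
  finally show ?thesis by simp
qed

lemma Max_bounded_difference:
  fixes f g :: "'a \<Rightarrow> real"
  assumes "finite T" "T \<noteq> {}" "\<And>a. a \<in> T \<Longrightarrow> \<bar>f a - g a\<bar> \<le> c"
  shows "\<bar>Max (f ` T) - Max (g ` T)\<bar> \<le> c"
proof -
  have *: "Max (f ` T) \<le> Max (g ` T) + c" if "\<And>a. a \<in> T \<Longrightarrow> \<bar>f a - g a\<bar> \<le> c" for f g :: "'a \<Rightarrow> real"
  proof (rule Max.boundedI)
    fix y assume "y \<in> f ` T"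
    then obtain a where a: "a \<in> T" "y = f a" by blast
    have "g a \<le> Max (g ` T)" using a assms(1) by simp
    then show "y \<le> Max (g ` T) + c" using that[OF a(1)] a(2) by linarith
  qed (use assms in auto)
  show ?thesis
    using *[of f g] *[of g f] assms(3) by (simp add: abs_le_iff abs_minus_commute)
qed

text \<open>With T = n t^2, one walk reaches the level with probability at least q and two with at
  most Q q^2; \<open>R\<close> provides enough walks for a mean of at least 1/4. The condition on n
  t^3 keeps the overlap correction bounded, that on d^2 T makes the tilted tails small; 68 is 4 +
  64.\<close>

lemma lag_sum_large_prob:
  fixes t d :: real
  assumes S: "S \<ge> 1" and L: "L < N" and d: "0 < d" "d < 1" and t: "0 < t" "t \<le> 1"
  defines "n \<equiv> N - L"
  assumes t3: "n * t ^ 3 \<le> 1 / 2" and t2: "4 \<le> d\<^sup>2 * (n * t\<^sup>2)"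
    and R: "exp ((1 / 2 + d) * (n * t\<^sup>2)) \<le> L choose (k - 1)"
  shows "exp (- (4 * d * (n * t\<^sup>2))) / 68
           \<le> avg (grid N S) (\<lambda>e. of_bool (\<exists>A\<in>lag_sets L k. (1 - d) * n * t \<le> lag_sum L n A e))"
proof -
  have n: "n > 0" using L by (simp add: n_def)
  define T where "T = n * t\<^sup>2"
  have T: "T > 0" using n t by (simp add: T_def)
  define q where "q = exp (- ((1 / 2 + d) * T)) / 4"
  define Q where "Q = 64 * exp (4 * d * T)"
  have e1: "exp (1::real) \<le> 3" by (rule exp_le)
  have e2: "exp (- (2::real)) \<le> 1 / 4"
  proof -
    have "(2::real)\<^sup>2 \<le> (exp 1)\<^sup>2" using exp_ge_add_one_self[of 1] by (intro power_mono) auto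
    then have "4 \<le> exp (2::real)" by (simp add: power2_eq_square mult_exp_exp)
    then show ?thesis by (simp add: exp_minus field_simps)
  qed
  have t4: "n * t ^ 4 \<le> 1 / 2"
  proof -
    have "n * t ^ 4 \<le> n * t ^ 3"
      using t by (intro mult_left_mono power_decreasing) auto
    then show ?thesis using t3 by linarith
  qed
  \<comment> \<open>From ln (1 + u) >= u - u^2 at u = t^2 / 2, with loss n t^4 / 4 in the exponent.
    The factor 3/4 leaves 1/4 after the two tails, each at most exp (T / 2) / 4, are
    subtracted.\<close>
  have ch: "3 / 4 * exp (T / 2) \<le> cosh t ^ n"
  proof -
    have "t\<^sup>2 / 2 - (t\<^sup>2 / 2)\<^sup>2 \<le> ln (1 + t\<^sup>2 / 2)"
      using t power_le_one[of t 2] by (intro ln_one_plus_pos_lower_bound) auto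
    also have "\<dots> \<le> ln (cosh t)"
      using cosh_ge_one_plus[of t] by (intro ln_mono) (auto intro: add_pos_nonneg)
    finally have "n * (t\<^sup>2 / 2 - (t\<^sup>2 / 2)\<^sup>2) \<le> n * ln (cosh t)"
      by (intro mult_left_mono) auto
    moreover have "n * (t\<^sup>2 / 2 - (t\<^sup>2 / 2)\<^sup>2) = T / 2 - n * t ^ 4 / 4"
      by (simp add: T_def power2_eq_square power4_eq_xxxx field_simps)
    ultimately have "T / 2 - 1 / 4 \<le> n * ln (cosh t)" using t4 by linarith
    then have "exp (T / 2 - 1 / 4) \<le> exp (n * ln (cosh t))" by simp
    also have "\<dots> = cosh t ^ n" by (simp add: exp_of_nat_mult)
    finally have "exp (T / 2) * exp (- (1 / 4)) \<le> cosh t ^ n" by (simp add: mult_exp_exp)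
    moreover have "exp (T / 2) * (3 / 4) \<le> exp (T / 2) * exp (- (1 / 4))"
      using exp_ge_add_one_self[of "- (1 / 4)"] by (intro mult_left_mono) auto
    ultimately show ?thesis by linarith
  qed
  have one: "q \<le> avg (grid N S) (\<lambda>e. of_bool ((1 - d) * n * t \<le> lag_sum L n A e))"
    if A: "A \<in> lag_sets L k" for A
  proof -
    have "exp (n * t\<^sup>2 / 2 * (1 - d\<^sup>2)) = exp (T / 2) * exp (- (d\<^sup>2 * T / 2))"
      by (simp add: mult_exp_exp T_def field_simps)
    also have "exp (- (d\<^sup>2 * T / 2)) \<le> exp (- 2)"
      using t2 by (simp add: T_def)
    also note e2
    finally have "exp (n * t\<^sup>2 / 2 * (1 - d\<^sup>2)) \<le> exp (T / 2) * (1 / 4)"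
      by simp
    then have "exp (T / 2) * (1 / 4) \<le> cosh t ^ n - 2 * exp (n * t\<^sup>2 / 2 * (1 - d\<^sup>2))"
      using ch by linarith
    then have "exp (- (1 + d) * n * t\<^sup>2) * (exp (T / 2) * (1 / 4)) \<le>
        exp (- (1 + d) * n * t\<^sup>2) * (cosh t ^ n - 2 * exp (n * t\<^sup>2 / 2 * (1 - d\<^sup>2)))"
      by (rule mult_left_mono) simp
    also have "\<dots> \<le> avg (grid N S) (\<lambda>e. of_bool ((1 - d) * n * t \<le> lag_sum L n A e))"
      unfolding lag_sum_def
      by (rule sign_walk_lower_tail[OF finite_grid lag_walk[OF A S L, folded n_def] t(1) d])
    also have "exp (- (1 + d) * n * t\<^sup>2) * (exp (T / 2) * (1 / 4)) = q"
      by (simp add: q_def T_def mult_exp_exp field_simps)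
    finally show ?thesis .
  qed
  have two: "avg (grid N S) (\<lambda>e. of_bool ((1 - d) * n * t \<le> lag_sum L n A e \<and> (1 - d) * n * t \<le> lag_sum L n B e))
      \<le> Q * q\<^sup>2"
    if A: "A \<in> lag_sets L k" and B: "B \<in> lag_sets L k" and AB: "A \<noteq> B" for A B
  proof -
    obtain r where r: "sign_walk (grid N S) n r
        (\<lambda>j e. pat (lag_pat A) (L + 1 + j) e * pat (lag_pat B) (L + 1 + j) e)"
      using lag_walk_mult[OF A B S L AB] unfolding n_def by blast
    \<comment> \<open>The choice b = 2 n t makes the overlap tail exp (- 2 T), below the main term,
      while the correction t^2 b = 2 n t^3 is at most 1.\<close>
    have b: "0 \<le> 2 * real n * t" using t by simp
    have "avg (grid N S) (\<lambda>e. of_bool ((1 - d) * n * t \<le> lag_sum L n A e \<and> (1 - d) * n * t \<le> lag_sum L n B e))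
        \<le> exp (- (2 * real n * t)\<^sup>2 / (2 * real n)) + exp (real n * t\<^sup>2 + t\<^sup>2 * (2 * real n * t) - 2 * t * ((1 - d) * n * t))"
      unfolding lag_sum_def
      by (rule sign_walk_pair_upper_tail[OF finite_grid lag_walk[OF A S L, folded n_def]
            lag_walk[OF B S L, folded n_def] r _ b n]) (use t in auto)
    also have "- (2 * real n * t)\<^sup>2 / (2 * real n) = - (2 * T)"
      using n by (simp add: T_def power2_eq_square)
    also have "exp (- (2 * T)) \<le> exp (2 * d * T - T)"
      using T d by (simp add: mult_nonneg_nonneg add_increasing)
    also have "real n * t\<^sup>2 + t\<^sup>2 * (2 * real n * t) - 2 * t * ((1 - d) * n * t) = 2 * (n * t ^ 3) + (2 * d * T - T)"
      by (simp add: T_def power2_eq_square power3_eq_cube algebra_simps)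
    also have "exp (2 * (n * t ^ 3) + (2 * d * T - T)) \<le> exp (1 + (2 * d * T - T))"
      using t3 by simp
    also have "\<dots> = exp 1 * exp (2 * d * T - T)"
      by (simp add: mult_exp_exp)
    also have "\<dots> \<le> 3 * exp (2 * d * T - T)"
      using e1 by simp
    also have "exp (2 * d * T - T) + 3 * exp (2 * d * T - T) = Q * q\<^sup>2"
      by (simp add: Q_def q_def power2_eq_square mult_exp_exp field_simps)
    finally show ?thesis by simp
  qed
  have "1 / (4 + Q) \<le> avg (grid N S) (\<lambda>e. of_bool (\<exists>A\<in>lag_sets L k. (1 - d) * n * t \<le> lag_sum L n A e))"
  proof (rule avg_second_moment[where q = q])
    have "exp ((1 / 2 + d) * T) * q \<le> card (lag_sets L k) * q"
      using R by (intro mult_right_mono) (auto simp: card_lag_sets T_def q_def)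
    then show "1 / 4 \<le> card (lag_sets L k) * q"
      by (simp add: q_def mult_exp_exp)
  qed (use one two in \<open>auto simp: q_def Q_def\<close>)
  moreover have "exp (- (4 * d * T)) / 68 \<le> 1 / (4 + Q)"
  proof -
    have "1 \<le> exp (4 * d * T)" using d T by simp
    then have "4 + Q \<le> 68 * exp (4 * d * T)" by (simp add: Q_def)
    moreover have "0 < 4 + Q" by (simp add: Q_def add_pos_pos)
    ultimately have "1 / (68 * exp (4 * d * T)) \<le> 1 / (4 + Q)" by (intro divide_left_mono) auto
    then show ?thesis by (simp add: exp_minus field_simps)
  qed
  ultimately show ?thesis unfolding T_def by linarith
qed

text \<open>The second moment only yields a probability that decays like a small power of N, but this
  exceeds the probability of a large deviation of the maximum above its mean, which bounds the
  mean from below.\<close>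

lemma avg_cross_corr_lower_tail:
  fixes t d x :: real and n :: nat
  assumes k: "k \<ge> 1" and S: "S \<ge> 1" and L: "k - 1 \<le> L" "L < N"
    and d: "0 < d" "d < 1" and t: "0 < t" "t \<le> 1"
  defines "n \<equiv> N - L"
  assumes t3: "n * t ^ 3 \<le> 1 / 2" and t2: "4 \<le> d\<^sup>2 * (n * t\<^sup>2)"
    and R: "exp ((1 / 2 + d) * (n * t\<^sup>2)) \<le> L choose (k - 1)"
    and x: "0 \<le> x" "exp (- x\<^sup>2 / (2 * (real k)\<^sup>2 * (real N * real S))) < exp (- (4 * d * (n * t\<^sup>2))) / 68"
  shows "avg (grid N S) (\<lambda>e. of_bool (cross_corr k (\<lambda>n s. e (n, s)) N S \<le> (1 - d) * n * t - 2 * x))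
           \<le> exp (- x\<^sup>2 / (2 * (real k)\<^sup>2 * (real N * real S)))"
proof -
  let ?I = "grid N S" and ?l = "(1 - d) * n * t"
  let ?E = "exp (- x\<^sup>2 / (2 * (real k)\<^sup>2 * (real N * real S)))"
  have ne: "lag_sets L k \<noteq> {}"
    using card_lag_sets[of L k] L(1) by (metis binomial_eq_0_iff card.empty not_le)
  define f where "f e = Max ((\<lambda>A. lag_sum L n A e) ` lag_sets L k)" for e
  have bd: "\<bar>f (flip i e) - f e\<bar> \<le> 2 * real k" if "i \<in> ?I" "e \<in> sgns ?I" for i e
    unfolding f_def n_def
    by (rule Max_bounded_difference[OF finite_lag_sets ne])
      (rule lag_sum_bounded_differences[OF _ k S L(2) that])
  have Ine: "?I \<noteq> {}" using L(2) S by (auto simp: grid_def)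
  have k0: "0 < real k" using k by simp
  \<comment> \<open>Applied to f, to bound its mean from below, and to -f, to bound f by its mean;
    each use costs one x, whence the 2 x in the statement.\<close>
  have conc: "avg ?I (\<lambda>e. of_bool (avg ?I g + x \<le> g e)) \<le> ?E"
    if "\<And>i e. i \<in> ?I \<Longrightarrow> e \<in> sgns ?I \<Longrightarrow> \<bar>g (flip i e) - g e\<bar> \<le> 2 * real k" for g
    using avg_concentration[OF finite_grid Ine k0 that x(1)] by (simp add: card_grid)
  have f_ge: "?l \<le> f e \<longleftrightarrow> (\<exists>A\<in>lag_sets L k. ?l \<le> lag_sum L n A e)" for e
    unfolding f_def using ne by (subst Max_ge_iff) auto
  have mean: "?l < avg ?I f + x"
  proof (rule ccontr)
    assume c: "\<not> ?l < avg ?I f + x"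
    have "exp (- (4 * d * (n * t\<^sup>2))) / 68 \<le> avg ?I (\<lambda>e. of_bool (?l \<le> f e))"
      unfolding f_ge by (rule lag_sum_large_prob[OF S L(2) d t, folded n_def, OF t3 t2 R])
    also have "\<dots> \<le> avg ?I (\<lambda>e. of_bool (avg ?I f + x \<le> f e))"
      by (rule avg_mono) (use c in auto)
    also have "\<dots> \<le> ?E" by (rule conc[OF bd])
    finally show False using x(2) by simp
  qed
  have "avg ?I (\<lambda>e. of_bool (cross_corr k (\<lambda>n s. e (n, s)) N S \<le> ?l - 2 * x))
      \<le> avg ?I (\<lambda>e. of_bool (avg ?I (\<lambda>e. - f e) + x \<le> - f e))"
  proof (rule avg_mono)
    fix e
    have "f e \<le> cross_corr k (\<lambda>n s. e (n, s)) N S"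
      unfolding f_def n_def using ne lag_sum_le_cross_corr[OF _ k L(2) S] by (subst Max_le_iff) auto
    moreover have "avg ?I (\<lambda>e. - f e) = - avg ?I f"
      using avg_cmult[of ?I "-1" f] by simp
    ultimately show "of_bool (cross_corr k (\<lambda>n s. e (n, s)) N S \<le> ?l - 2 * x)
        \<le> (of_bool (avg ?I (\<lambda>e. - f e) + x \<le> - f e) :: real)"
      using mean by auto
  qed
  also have "\<dots> \<le> ?E"
    by (rule conc) (use bd in \<open>simp add: abs_minus_commute\<close>)
  finally show ?thesis .
qed


section \<open>From finite averages to the infinite product measure\<close>

text \<open>The event is a finite disjoint union of cylinders, one per sign vector in B, each of
  measure 2 to the power minus the grid size.\<close>

lemma sign_space_cylinder:
  assumes B: "B \<subseteq> sgns (grid N S)"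
  defines "E \<equiv> {\<omega> \<in> space (sign_space S). restrict \<omega> (grid N S) \<in> B}"
  shows "E \<in> sets (sign_space S)"
    and "measure (sign_space S) E = avg (grid N S) (\<lambda>e. of_bool (e \<in> B))"
proof -
  let ?p = "measure_pmf (pmf_of_set {-1, 1::real})"
  let ?U = "{1::nat..} \<times> {1..S}"
  interpret product_prob_space "\<lambda>_. ?p" ?U
    by (rule product_prob_spaceI) (rule measure_pmf.prob_space_axioms)
  have sub: "grid N S \<subseteq> ?U" by (auto simp: grid_def)
  have fin: "finite B" using B finite_subset finite_sgns finite_grid by blast
  define C where "C x = prod_emb ?U (\<lambda>_. ?p) (grid N S) (Pi\<^sub>E (grid N S) (\<lambda>i. {x i}))" for x :: "nat \<times> nat \<Rightarrow> real"
  have C_sets: "C x \<in> sets (sign_space S)" for x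
    unfolding C_def sign_space_def by (rule sets_PiM_I) (use sub in auto)
  have C_eq: "C x = {\<omega> \<in> space (sign_space S). restrict \<omega> (grid N S) = x}" if "x \<in> B" for x
  proof -
    have "x \<in> extensional (grid N S)"
      using that B by (auto simp: sgns_def PiE_def)
    then have "Pi\<^sub>E (grid N S) (\<lambda>i. {x i}) = {x}" by (rule PiE_singleton)
    then show ?thesis
      by (auto simp: C_def prod_emb_def sign_space_def space_PiM)
  qed
  have C_meas: "measure (sign_space S) (C x) = 1 / 2 ^ card (grid N S)" if x: "x \<in> B" for x
  proof -
    have "measure (sign_space S) (C x) = (\<Prod>i\<in>grid N S. measure ?p {x i})"
      unfolding C_def sign_space_def by (rule measure_PiM_emb) (use sub in auto)
    also have "\<dots> = (\<Prod>i\<in>grid N S. 1 / 2)"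
    proof (rule prod.cong[OF refl])
      fix i assume "i \<in> grid N S"
      then have "x i = 1 \<or> x i = -1" using sgns_cases[of x "grid N S" i] x B by auto
      then show "measure ?p {x i} = 1 / 2"
        by (auto simp: measure_pmf_single)
    qed
    finally show ?thesis by (simp add: power_divide)
  qed
  have E: "E = (\<Union>x\<in>B. C x)"
    unfolding E_def using C_eq by auto
  show "E \<in> sets (sign_space S)"
    unfolding E using C_sets fin by blast
  have "disjoint_family_on C B"
    unfolding disjoint_family_on_def using C_eq by auto
  moreover have "finite_measure (sign_space S)"
    unfolding sign_space_def by unfold_locales
  ultimately have "measure (sign_space S) E = (\<Sum>x\<in>B. measure (sign_space S) (C x))"
    unfolding E using C_sets fin by (intro finite_measure.finite_measure_finite_Union) auto
  also have "\<dots> = card B / 2 ^ card (grid N S)"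
    using C_meas by simp
  also have "real (card B) = (\<Sum>e\<in>sgns (grid N S). of_bool (e \<in> B))"
    using B by (simp add: Int_absorb1)
  finally show "measure (sign_space S) E = avg (grid N S) (\<lambda>e. of_bool (e \<in> B))"
    by (simp add: avg_def)
qed

lemma prob_space_sign_space: "prob_space (sign_space S)"
  unfolding sign_space_def by (rule prob_space_PiM) (rule measure_pmf.prob_space_axioms)

text \<open>\<open>sign_space\<close> consists of all real-valued families; that the values are
  signs holds only almost surely.\<close>

lemma AE_restrict_sgns: "AE \<omega> in sign_space S. \<forall>N. restrict \<omega> (grid N S) \<in> sgns (grid N S)"
proof -
  interpret prob_space "sign_space S" by (rule prob_space_sign_space)
  have "AE \<omega> in sign_space S. restrict \<omega> (grid N S) \<in> sgns (grid N S)" for N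
  proof -
    let ?E = "{\<omega> \<in> space (sign_space S). restrict \<omega> (grid N S) \<in> sgns (grid N S)}"
    have "avg (grid N S) (\<lambda>e. of_bool (e \<in> sgns (grid N S))) = avg (grid N S) (\<lambda>_. 1)"
      by (rule avg_cong) simp
    then have "prob ?E = 1"
      using sign_space_cylinder(2)[of "sgns (grid N S)" N S] by (simp add: avg_const)
    then have "AE \<omega> in sign_space S. \<omega> \<in> ?E"
      by (rule AE_prob_1)
    then show ?thesis by eventually_elim simp
  qed
  then show ?thesis by (simp add: AE_all_countable)
qed

text \<open>The Borel-Cantelli lemma with the probabilities expressed as finite averages.\<close>

lemma AE_eventually_not:
  fixes r :: "nat \<Rightarrow> nat" and P :: "nat \<Rightarrow> (nat \<times> nat \<Rightarrow> real) \<Rightarrow> bool"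
  assumes "summable (\<lambda>j. avg (grid (r j) S) (\<lambda>e. of_bool (P j e)))"
  shows "AE \<omega> in sign_space S. \<forall>\<^sub>F j in sequentially. \<not> P j (restrict \<omega> (grid (r j) S))"
proof -
  interpret prob_space "sign_space S" by (rule prob_space_sign_space)
  define B where "B j = {e \<in> sgns (grid (r j) S). P j e}" for j
  define A where "A j = {\<omega> \<in> space (sign_space S). restrict \<omega> (grid (r j) S) \<in> B j}" for j
  have B: "B j \<subseteq> sgns (grid (r j) S)" for j by (auto simp: B_def)
  have m: "prob (A j) = avg (grid (r j) S) (\<lambda>e. of_bool (P j e))" for j
    unfolding A_def sign_space_cylinder(2)[OF B] by (rule avg_cong) (simp add: B_def)
  have "AE \<omega> in sign_space S. \<forall>\<^sub>F j in sequentially. \<omega> \<in> space (sign_space S) - A j"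
  proof (rule borel_cantelli_AE1)
    show "A j \<in> sets (sign_space S)" for j
      unfolding A_def by (rule sign_space_cylinder(1)[OF B])
  qed (use assms in \<open>auto simp: m less_top[symmetric]\<close>)
  with AE_restrict_sgns[of S] show ?thesis
  proof eventually_elim
    case (elim \<omega>)
    from elim(2) show ?case
      by eventually_elim (use elim(1) in \<open>auto simp: A_def B_def\<close>)
  qed
qed

section \<open>Asymptotics\<close>

text \<open>The normalisation of the theorem is asymptotic to this simpler one.\<close>

definition corr_scale :: "nat \<Rightarrow> nat \<Rightarrow> real" where
  "corr_scale k N = sqrt (2 * real (k - 1) * real N * ln (real N))"

lemma corr_scale_square: "1 \<le> N \<Longrightarrow> (corr_scale k N)\<^sup>2 = 2 * real (k - 1) * real N * ln (real N)"
  by (simp add: corr_scale_def)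

lemma corr_scale_nonneg: "1 \<le> N \<Longrightarrow> 0 \<le> corr_scale k N"
  by (simp add: corr_scale_def)

lemma corr_scale_pos: "2 \<le> k \<Longrightarrow> 2 \<le> N \<Longrightarrow> 0 < corr_scale k N"
  by (simp add: corr_scale_def)

lemma corr_scale_mono: "1 \<le> N \<Longrightarrow> N \<le> N' \<Longrightarrow> corr_scale k N \<le> corr_scale k N'"
  unfolding corr_scale_def by (intro real_sqrt_le_mono mult_mono) auto

lemma ln_binomial_le: "1 \<le> m \<Longrightarrow> m \<le> N \<Longrightarrow> ln (real (N choose m)) \<le> m * ln (real N)"
proof -
  assume m: "1 \<le> m" "m \<le> N"
  have "real (N choose m) \<le> real (N ^ m)"
    using binomial_le_pow[OF m(2)] by (simp only: of_nat_le_iff)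
  then have "ln (real (N choose m)) \<le> ln (real N ^ m)"
    using m by (intro ln_mono) (auto simp: zero_less_binomial)
  then show ?thesis using m by (simp add: ln_realpow)
qed

lemma ln_binomial_ge: "1 \<le> m \<Longrightarrow> m \<le> N \<Longrightarrow> m * (ln (real N) - ln (real m)) \<le> ln (real (N choose m))"
proof -
  assume m: "1 \<le> m" "m \<le> N"
  have "(real N / real m) ^ m \<le> real (N choose m)"
    by (rule binomial_ge_n_over_k_pow_k[OF m(2)])
  then have "ln ((real N / real m) ^ m) \<le> ln (real (N choose m))"
    using m by (intro ln_mono) auto
  then show ?thesis using m by (simp add: ln_realpow ln_div)
qed

lemma corr_scale_over_norm_tendsto:
  assumes k: "k \<ge> 2"
  shows "(\<lambda>N. corr_scale k N / sqrt (2 * real N * ln (real (N choose (k - 1))))) \<longlonglongrightarrow> 1"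
proof -
  define m where "m = k - 1"
  have m: "1 \<le> m" using k by (simp add: m_def)
  have "(\<lambda>N. ln (real (N choose m)) / (m * ln (real N))) \<longlonglongrightarrow> 1"
  proof (rule tendsto_sandwich)
    show "\<forall>\<^sub>F N in sequentially. (ln (real N) - ln (real m)) / ln (real N) \<le> ln (real (N choose m)) / (m * ln (real N))"
      using eventually_ge_at_top[of "max 2 m"]
    proof eventually_elim
      case (elim N)
      then have "0 < ln (real N)" by simp
      then have "m * (ln (real N) - ln (real m)) / (m * ln (real N)) \<le> ln (real (N choose m)) / (m * ln (real N))"
        using ln_binomial_ge[OF m, of N] elim by (intro divide_right_mono) auto
      then show ?case using m by simp
    qed
    show "\<forall>\<^sub>F N in sequentially. ln (real (N choose m)) / (m * ln (real N)) \<le> 1"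
      using eventually_ge_at_top[of "max 2 m"]
    proof eventually_elim
      case (elim N)
      then have "0 < ln (real N)" by simp
      then show ?case using ln_binomial_le[OF m, of N] m elim by (simp add: field_simps)
    qed
    show "(\<lambda>N. (ln (real N) - ln (real m)) / ln (real N)) \<longlonglongrightarrow> 1"
      using m by real_asymp
  qed auto
  then have "(\<lambda>N. sqrt (inverse (ln (real (N choose m)) / (m * ln (real N))))) \<longlonglongrightarrow> sqrt (inverse 1)"
    by (intro tendsto_intros) auto
  then have lim: "(\<lambda>N. sqrt (inverse (ln (real (N choose m)) / (m * ln (real N))))) \<longlonglongrightarrow> 1"
    by simp
  show ?thesis
  proof (rule Lim_transform_eventually[OF lim])
    show "\<forall>\<^sub>F N in sequentially. sqrt (inverse (ln (real (N choose m)) / (m * ln (real N)))) =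
        corr_scale k N / sqrt (2 * real N * ln (real (N choose (k - 1))))"
      using eventually_ge_at_top[of 2]
    proof eventually_elim
      case (elim N)
      have "corr_scale k N / sqrt (2 * real N * ln (real (N choose (k - 1)))) =
          sqrt ((2 * real m * real N * ln (real N)) / (2 * real N * ln (real (N choose m))))"
        by (simp only: corr_scale_def m_def real_sqrt_divide)
      also have "(2 * real m * real N * ln (real N)) / (2 * real N * ln (real (N choose m))) =
          inverse (ln (real (N choose m)) / (m * ln (real N)))"
        using elim by (simp add: field_simps)
      finally show ?case by simp
    qed
  qed
qed

section \<open>Tail probabilities as powers of N\<close>

lemma cross_corr_upper_tail_eventually:
  assumes S: "S \<ge> 1" and k: "k \<ge> 2" and \<epsilon>: "\<epsilon> > 0"
  shows "\<exists>C c. c > 0 \<and> (\<forall>\<^sub>F N in sequentially.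
    avg (grid N S) (\<lambda>e. of_bool ((1 + \<epsilon>) * corr_scale k N \<le> cross_corr k (\<lambda>n s. e (n, s)) N S))
      \<le> C * real N powr - c)"
proof (intro exI conjI)
  \<comment> \<open>The tail exponent (k - 1) (1 + \<epsilon>)^2 minus the exponent k - 1 of the
    number of patterns.\<close>
  define c where "c = real (k - 1) * ((1 + \<epsilon>)\<^sup>2 - 1)"
  define C where "C = 4 * real S ^ k"
  have "(1 + \<epsilon>)\<^sup>2 - 1 = \<epsilon> * (2 + \<epsilon>)" by (simp add: power2_eq_square algebra_simps)
  then show "c > 0" using k \<epsilon> by (simp add: c_def)
  show "\<forall>\<^sub>F N in sequentially.
    avg (grid N S) (\<lambda>e. of_bool ((1 + \<epsilon>) * corr_scale k N \<le> cross_corr k (\<lambda>n s. e (n, s)) N S))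
      \<le> C * real N powr - c"
    using eventually_ge_at_top[of "max 2 k"]
  proof eventually_elim
    case (elim N)
    then have N: "2 \<le> N" "k \<le> N" by auto
    have "avg (grid N S) (\<lambda>e. of_bool ((1 + \<epsilon>) * corr_scale k N \<le> cross_corr k (\<lambda>n s. e (n, s)) N S))
      \<le> real (S * (N * S) ^ (k - 1)) * (4 * exp (- ((1 + \<epsilon>) * corr_scale k N)\<^sup>2 / (2 * real N)))"
      using k N S \<epsilon> corr_scale_pos[OF k N(1)] by (intro avg_cross_corr_upper_tail) auto
    also have "- ((1 + \<epsilon>) * corr_scale k N)\<^sup>2 / (2 * real N) = - ((1 + \<epsilon>)\<^sup>2 * real (k - 1)) * ln (real N)"
      unfolding power_mult_distrib corr_scale_square[OF order_trans[OF one_le_numeral N(1)]]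
      using N by (simp add: field_simps)
    also have "exp \<dots> = real N powr - ((1 + \<epsilon>)\<^sup>2 * real (k - 1))"
      using N by (simp add: powr_def)
    also have "real (S * (N * S) ^ (k - 1)) = real S ^ k * real N powr real (k - 1)"
    proof -
      have "real S * real S ^ (k - 1) = real S ^ k"
        using k by (cases k) auto
      then show ?thesis using N by (simp add: powr_realpow power_mult_distrib algebra_simps)
    qed
    also have "real S ^ k * real N powr real (k - 1) * (4 * real N powr - ((1 + \<epsilon>)\<^sup>2 * real (k - 1)))
        = C * real N powr (real (k - 1) + - ((1 + \<epsilon>)\<^sup>2 * real (k - 1)))"
      by (simp only: C_def powr_add mult_ac)
    also have "real (k - 1) + - ((1 + \<epsilon>)\<^sup>2 * real (k - 1)) = - c"
      by (simp add: c_def algebra_simps)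
    finally show ?case .
  qed
qed

lemma cross_corr_lower_tail_eventually:
  assumes S: "S \<ge> 1" and k: "k \<ge> 2" and \<epsilon>: "0 < \<epsilon>" "\<epsilon> < 1"
  shows "\<exists>c>0. \<forall>\<^sub>F N in sequentially.
    avg (grid N S) (\<lambda>e. of_bool (cross_corr k (\<lambda>n s. e (n, s)) N S \<le> (1 - \<epsilon>) * corr_scale k N))
      \<le> real N powr - c"
proof -
  define \<kappa> where "\<kappa> = real (k - 1)"
  have \<kappa>: "\<kappa> \<ge> 1" using k by (simp add: \<kappa>_def)
  \<comment> \<open>The level loses at most a fraction 3 d + 2 \<gamma> of the scale; with d at most
    \<gamma> this stays below \<epsilon>.\<close>
  define \<gamma> where "\<gamma> = \<epsilon> / 8"
  have \<gamma>: "0 < \<gamma>" "\<gamma> < 1 / 8" using \<epsilon> by (auto simp: \<gamma>_def)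
  define D where "D = (real k)\<^sup>2 * real S"
  have D: "D \<ge> 4"
  proof -
    have "2\<^sup>2 * 1 \<le> (real k)\<^sup>2 * real S" using k S by (intro mult_mono power_mono) auto
    then show ?thesis by (simp add: D_def)
  qed
  \<comment> \<open>Chosen so that 8 d \<kappa> = c / 2 for the concentration exponent c defined
    below: the second moment probability, of order at least N^(-c/2), then exceeds N^(-c).\<close>
  define d where "d = \<gamma>\<^sup>2 / (16 * D)"
  have d0: "0 < d" using \<gamma> D by (simp add: d_def)
  have d\<gamma>: "d \<le> \<gamma>"
  proof -
    have "\<gamma>\<^sup>2 \<le> \<gamma> * (16 * D)"
      using \<gamma> D by (simp add: power2_eq_square)
    then show ?thesis using D by (simp add: d_def field_simps)
  qed
  have d1: "d < 1 / 8" using d\<gamma> \<gamma> by simp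
  \<comment> \<open>Lowers the level just enough for (1 + 2 d) \<theta> < 1. The surplus \<eta>
    absorbs the constant factors lost in comparing L choose (k - 1) with N^(k-1).\<close>
  define \<theta> where "\<theta> = (1 - d)\<^sup>2"
  have \<theta>: "0 < \<theta>" "\<theta> \<le> 1" using d0 d1 by (auto simp: \<theta>_def power_le_one)
  define \<eta> where "\<eta> = 1 - (1 + 2 * d) * \<theta>"
  have \<eta>: "0 < \<eta>"
  proof -
    have "\<eta> = d\<^sup>2 * (3 - 2 * d)" by (simp add: \<eta>_def \<theta>_def power2_eq_square algebra_simps)
    then show ?thesis using d0 d1 by simp
  qed
  define c where "c = \<gamma>\<^sup>2 * \<kappa> / D"
  have c: "0 < c" using \<gamma> \<kappa> D by (simp add: c_def)
  have cd: "8 * d * \<theta> * \<kappa> \<le> c / 2"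
  proof -
    have "8 * d * \<theta> * \<kappa> = \<theta> * (c / 2)" using D by (simp add: d_def c_def field_simps)
    also have "\<dots> \<le> 1 * (c / 2)" using \<theta> c by (intro mult_right_mono) auto
    finally show ?thesis by simp
  qed
  define q where "q = nat \<lceil>1 / d\<rceil>"
  have qd: "1 / d \<le> real q" by (simp add: q_def real_nat_ceiling_ge)
  have "8 < 1 / d" using d0 d1 by (simp add: field_simps)
  then have q8: "8 < real q" using qd by linarith
  then have q2: "q \<ge> 2" by linarith
  have \<kappa>0: "0 < \<kappa>" using \<kappa> by simp
  have lim1: "(\<lambda>N::nat. 4 * \<kappa> * ln (real N) / real N) \<longlonglongrightarrow> 0"
    using \<kappa>0 by real_asymp
  have lim2: "(\<lambda>N::nat. 2 * \<kappa> * ln (real N) * sqrt (4 * \<kappa> * ln (real N) / real N)) \<longlonglongrightarrow> 0"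
    using \<kappa>0 by real_asymp
  have lnlim: "filterlim (\<lambda>N::nat. ln (real N)) at_top sequentially"
    by real_asymp
  have ev1: "\<forall>\<^sub>F N in sequentially. 4 * \<kappa> * ln (real N) / real N < 1"
    using lim1 by (rule order_tendstoD) simp
  have ev2: "\<forall>\<^sub>F N in sequentially. 2 * \<kappa> * ln (real N) * sqrt (4 * \<kappa> * ln (real N) / real N) < 1 / 2"
    using lim2 by (rule order_tendstoD) simp
  have evln: "\<forall>\<^sub>F N in sequentially. b \<le> ln (real N)" for b
    using lnlim by (simp add: filterlim_at_top)
  have "\<forall>\<^sub>F N in sequentially.
    avg (grid N S) (\<lambda>e. of_bool (cross_corr k (\<lambda>n s. e (n, s)) N S \<le> (1 - \<epsilon>) * corr_scale k N))
      \<le> real N powr - c"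
    using ev1 ev2 evln[of "4 / (d\<^sup>2 * 2 * \<theta> * \<kappa>)"] evln[of "(ln (2 * real q) + ln \<kappa>) / \<eta>"]
      evln[of "(ln 68 + 1) / (c / 2)"] eventually_ge_at_top[of "2 * q * k"]
  proof eventually_elim
    case (elim N)
    define L where "L = N div q"
    define n where "n = N - L"
    have N1: "2 \<le> N" "q * k \<le> N" "q \<le> N"
    proof -
      show "q * k \<le> N" using elim(6) by simp
      have "q \<le> q * k" using k by simp
      then show "q \<le> N" using \<open>q * k \<le> N\<close> by linarith
      then show "2 \<le> N" using q2 by simp
    qed
    have lnN: "0 < ln (real N)" using N1 by simp
    have kL: "k \<le> L"
      using N1(2) q2 by (simp add: L_def less_eq_div_iff_mult_less_eq mult.commute)
    have LN: "L < N" unfolding L_def using N1 q2 by (intro div_less_dividend) auto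
    have L_up: "real L \<le> d * real N"
    proof -
      have "real L \<le> real N / real q" unfolding L_def by (rule of_nat_div_le_of_nat)
      also have "\<dots> \<le> d * real N"
      proof -
        have "1 / real q \<le> d" using qd d0 q8 by (simp add: field_simps)
        then have "1 / real q * real N \<le> d * real N" by (rule mult_right_mono) simp
        then show ?thesis by simp
      qed
      finally show ?thesis .
    qed
    have L_low: "real N / (2 * real q) \<le> real L"
    proof -
      have "N < q * (L + 1)" unfolding L_def using q2 by (simp add: dividend_less_times_div)
      also have "\<dots> \<le> q * (2 * L)" using kL k by (intro mult_left_mono) auto
      finally have "real N \<le> real (q * (2 * L))" by (simp only: of_nat_le_iff)
      then show ?thesis using q8 by (simp add: field_simps)
    qed
    have n_real: "real n = real N - real L" using LN by (simp add: n_def of_nat_diff)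
    have n_low: "(1 - d) * real N \<le> real n" using L_up n_real by (simp add: algebra_simps)
    have n_half: "real N / 2 \<le> real n"
    proof -
      have "(1 / 2) * real N \<le> (1 - d) * real N" using d1 by (intro mult_right_mono) auto
      then show ?thesis using n_low by simp
    qed
    have n0: "0 < real n" using n_half N1 by linarith
    \<comment> \<open>Makes n t^2 = 2 \<theta> \<kappa> ln N, hence n t is close to the
      scale.\<close>
    define t where "t = sqrt (2 * \<theta> * \<kappa> * ln (real N) / real n)"
    have t_arg: "0 < 2 * \<theta> * \<kappa> * ln (real N) / real n"
      using \<theta> \<kappa>0 lnN n0 by simp
    have t0: "0 < t" using t_arg by (simp add: t_def)
    have nt2: "real n * t\<^sup>2 = 2 * \<theta> * \<kappa> * ln (real N)"
      using t_arg n0 by (simp add: t_def)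
    have t_arg_le: "2 * \<theta> * \<kappa> * ln (real N) / real n \<le> 4 * \<kappa> * ln (real N) / real N"
    proof -
      have "2 * \<theta> * \<kappa> * ln (real N) / real n \<le> (2 * 1 * \<kappa> * ln (real N)) / (real N / 2)"
        using \<theta> \<kappa>0 lnN n_half N1 by (intro frac_le mult_mono) auto
      then show ?thesis by simp
    qed
    have t_le: "t \<le> sqrt (4 * \<kappa> * ln (real N) / real N)"
      unfolding t_def using t_arg_le by (rule real_sqrt_le_mono)
    have t1: "t \<le> 1" unfolding t_def using t_arg_le elim(1) by simp
    have t3: "real n * t ^ 3 \<le> 1 / 2"
    proof -
      have "real n * t ^ 3 = (2 * \<theta> * \<kappa> * ln (real N)) * t"
        unfolding nt2[symmetric] by (simp add: power2_eq_square power3_eq_cube)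
      also have "\<dots> \<le> (2 * 1 * \<kappa> * ln (real N)) * sqrt (4 * \<kappa> * ln (real N) / real N)"
        using \<theta> \<kappa>0 lnN t0 t_le by (intro mult_mono) auto
      finally show ?thesis using elim(2) by simp
    qed
    have t2: "4 \<le> d\<^sup>2 * (real n * t\<^sup>2)"
      unfolding nt2 using elim(3) d0 \<theta> \<kappa>0 by (simp add: field_simps)
    have R: "exp ((1 / 2 + d) * (real n * t\<^sup>2)) \<le> real (L choose (k - 1))"
    proof -
      have L0: "0 < real L" using kL k by simp
      have "ln (real N) - ln (2 * real q) = ln (real N / (2 * real q))"
        using N1 q8 by (simp add: ln_div)
      also have "\<dots> \<le> ln (real L)"
        using L_low N1 q8 by (intro ln_mono) auto
      finally have "ln (real N) - ln (2 * real q) - ln \<kappa> \<le> ln (real L) - ln \<kappa>" by simp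
      moreover have "ln (2 * real q) + ln \<kappa> \<le> \<eta> * ln (real N)"
        using elim(4) \<eta> by (simp add: field_simps)
      ultimately have "(1 - \<eta>) * ln (real N) \<le> ln (real L) - ln \<kappa>" by (simp add: algebra_simps)
      then have "\<kappa> * ((1 - \<eta>) * ln (real N)) \<le> \<kappa> * (ln (real L) - ln \<kappa>)"
        using \<kappa>0 by (intro mult_left_mono) auto
      also have "\<dots> \<le> ln (real (L choose (k - 1)))"
        unfolding \<kappa>_def using k kL by (intro ln_binomial_ge) auto
      also have "\<kappa> * ((1 - \<eta>) * ln (real N)) = (1 / 2 + d) * (real n * t\<^sup>2)"
        unfolding nt2 \<eta>_def by (simp add: algebra_simps)
      finally have "exp ((1 / 2 + d) * (real n * t\<^sup>2)) \<le> exp (ln (real (L choose (k - 1))))"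
        by simp
      also have "\<dots> = real (L choose (k - 1))"
        using kL by (intro exp_ln) (simp add: zero_less_binomial)
      finally show ?thesis .
    qed
    define x where "x = \<gamma> * corr_scale k N"
    have x0: "0 \<le> x" unfolding x_def using \<gamma> corr_scale_nonneg[of N k] N1 by simp
    have xe: "- x\<^sup>2 / (2 * (real k)\<^sup>2 * (real N * real S)) = - c * ln (real N)"
    proof -
      have "x\<^sup>2 = \<gamma>\<^sup>2 * (2 * \<kappa> * real N * ln (real N))"
        unfolding x_def power_mult_distrib \<kappa>_def using N1 by (simp add: corr_scale_square)
      moreover have "2 * (real k)\<^sup>2 * (real N * real S) = 2 * real N * D"
        by (simp add: D_def)
      ultimately show ?thesis using N1 D by (simp add: c_def field_simps)
    qed
    have small: "exp (- x\<^sup>2 / (2 * (real k)\<^sup>2 * (real N * real S))) < exp (- (4 * d * (real n * t\<^sup>2))) / 68"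
    proof -
      have "4 * d * (real n * t\<^sup>2) = (8 * d * \<theta> * \<kappa>) * ln (real N)"
        unfolding nt2 by simp
      also have "\<dots> \<le> (c / 2) * ln (real N)"
        using cd lnN by (intro mult_right_mono) auto
      finally have A: "4 * d * (real n * t\<^sup>2) \<le> (c / 2) * ln (real N)" .
      have "ln 68 + 1 \<le> (c / 2) * ln (real N)"
        using elim(5) c by (simp add: field_simps)
      with A have "- c * ln (real N) < - (4 * d * (real n * t\<^sup>2)) - ln 68" by linarith
      then have "exp (- c * ln (real N)) < exp (- (4 * d * (real n * t\<^sup>2)) - ln 68)"
        by (simp only: exp_less_cancel_iff)
      then show ?thesis unfolding xe by (simp add: exp_diff)
    qed
    have level: "(1 - \<epsilon>) * corr_scale k N \<le> (1 - d) * real n * t - 2 * x"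
    proof -
      \<comment> \<open>Since n >= (1 - d) N and \<theta> = (1 - d)^2, n t is at least (1 - d)^(3/2)
        times the scale.\<close>
      have "(1 - d)\<^sup>2 * corr_scale k N \<le> real n * t"
      proof (rule power2_le_imp_le)
        have "((1 - d)\<^sup>2 * corr_scale k N)\<^sup>2 = \<theta> * (1 - d)\<^sup>2 * (2 * \<kappa> * real N * ln (real N))"
          unfolding power_mult_distrib \<theta>_def \<kappa>_def
            corr_scale_square[OF order_trans[OF one_le_numeral N1(1)]]
          by (simp add: power2_eq_square)
        also have "\<dots> \<le> \<theta> * (1 - d) * (2 * \<kappa> * real N * ln (real N))"
        proof -
          have "(1 - d)\<^sup>2 \<le> 1 - d" using d0 d1 by (simp add: power2_eq_square mult_left_le)
          then show ?thesis using \<theta> \<kappa>0 lnN by (intro mult_right_mono mult_left_mono) auto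
        qed
        also have "\<dots> = (2 * \<theta> * \<kappa> * ln (real N)) * ((1 - d) * real N)" by simp
        also have "\<dots> \<le> (2 * \<theta> * \<kappa> * ln (real N)) * real n"
          using n_low \<theta> \<kappa>0 lnN by (intro mult_left_mono) auto
        also have "\<dots> = (real n * t)\<^sup>2"
          unfolding nt2[symmetric] by (simp add: power2_eq_square)
        finally show "((1 - d)\<^sup>2 * corr_scale k N)\<^sup>2 \<le> (real n * t)\<^sup>2" .
        show "0 \<le> real n * t" using t0 by simp
      qed
      then have "(1 - d) * ((1 - d)\<^sup>2 * corr_scale k N) \<le> (1 - d) * (real n * t)"
        using d1 by (intro mult_left_mono) auto
      moreover have "(1 - 3 * d) * corr_scale k N \<le> (1 - d) * ((1 - d)\<^sup>2 * corr_scale k N)"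
      proof -
        have "(1 - d) * (1 - d)\<^sup>2 - (1 - 3 * d) = d\<^sup>2 * (3 - d)"
          by (simp add: power2_eq_square algebra_simps)
        moreover have "0 \<le> d\<^sup>2 * (3 - d)" using d1 by simp
        ultimately have "1 - 3 * d \<le> (1 - d) * (1 - d)\<^sup>2" by linarith
        then have "(1 - 3 * d) * corr_scale k N \<le> ((1 - d) * (1 - d)\<^sup>2) * corr_scale k N"
          using corr_scale_nonneg[of N k] N1 by (intro mult_right_mono) auto
        then show ?thesis by (simp only: mult.assoc)
      qed
      moreover have "(1 - \<epsilon>) * corr_scale k N \<le> (1 - 3 * d) * corr_scale k N - 2 * x"
      proof -
        have "1 - \<epsilon> \<le> 1 - 3 * d - 2 * \<gamma>" using d\<gamma> \<gamma> by (simp add: \<gamma>_def)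
        then have "(1 - \<epsilon>) * corr_scale k N \<le> (1 - 3 * d - 2 * \<gamma>) * corr_scale k N"
          using corr_scale_nonneg[of N k] N1 by (intro mult_right_mono) auto
        then show ?thesis by (simp add: x_def algebra_simps)
      qed
      ultimately show ?thesis by (simp add: mult.assoc)
    qed
    have "avg (grid N S) (\<lambda>e. of_bool (cross_corr k (\<lambda>n s. e (n, s)) N S \<le> (1 - \<epsilon>) * corr_scale k N))
        \<le> avg (grid N S) (\<lambda>e. of_bool (cross_corr k (\<lambda>n s. e (n, s)) N S \<le> (1 - d) * real n * t - 2 * x))"
      by (rule avg_mono) (use level in auto)
    also have "\<dots> \<le> exp (- x\<^sup>2 / (2 * (real k)\<^sup>2 * (real N * real S)))"
      using k kL d0 d1 unfolding n_def
      by (intro avg_cross_corr_lower_tail S LN t0 t1 t3[unfolded n_def] t2[unfolded n_def]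
          R[unfolded n_def] x0 small[unfolded n_def]) auto
    also have "\<dots> = real N powr - c"
      unfolding xe using N1 by (simp add: powr_def)
    finally show ?case .
  qed
  then show ?thesis using c by blast
qed

text \<open>The exponent m depends on \<epsilon> through the decay rate c: m c >= 2 bounds the
  failure probabilities by a multiple of j^(-2).\<close>

lemma AE_cross_corr_powers:
  assumes S: "S \<ge> 1" and k: "k \<ge> 2" and \<epsilon>: "0 < \<epsilon>" "\<epsilon> < 1"
  shows "\<exists>m\<ge>1. AE \<omega> in sign_space S. \<forall>\<^sub>F j in sequentially.
    (1 - \<epsilon>) * corr_scale k (j ^ m) < cross_corr k (\<lambda>n s. \<omega> (n, s)) (j ^ m) S \<and>
    cross_corr k (\<lambda>n s. \<omega> (n, s)) (j ^ m) S < (1 + \<epsilon>) * corr_scale k (j ^ m)"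
proof -
  let ?\<Phi> = "\<lambda>e N. cross_corr k (\<lambda>n s. e (n, s)) N S"
  obtain C c1 where c1: "c1 > 0" and up: "\<forall>\<^sub>F N in sequentially.
      avg (grid N S) (\<lambda>e. of_bool ((1 + \<epsilon>) * corr_scale k N \<le> ?\<Phi> e N)) \<le> C * real N powr - c1"
    using cross_corr_upper_tail_eventually[OF S k \<epsilon>(1)] by blast
  obtain c2 where c2: "c2 > 0" and lo: "\<forall>\<^sub>F N in sequentially.
      avg (grid N S) (\<lambda>e. of_bool (?\<Phi> e N \<le> (1 - \<epsilon>) * corr_scale k N)) \<le> real N powr - c2"
    using cross_corr_lower_tail_eventually[OF S k \<epsilon>] by blast
  define c where "c = min c1 c2"
  have c: "c > 0" using c1 c2 by (simp add: c_def)
  define m where "m = nat \<lceil>2 / c\<rceil>"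
  have cm: "2 \<le> c * real m"
  proof -
    have "2 / c \<le> real m" by (simp add: m_def real_nat_ceiling_ge)
    then show ?thesis using c by (simp add: field_simps)
  qed
  then have m: "m \<ge> 1" by (cases m) auto
  define P where "P j e \<longleftrightarrow> (1 + \<epsilon>) * corr_scale k (j ^ m) \<le> ?\<Phi> e (j ^ m) \<or> ?\<Phi> e (j ^ m) \<le> (1 - \<epsilon>) * corr_scale k (j ^ m)"
    for j :: nat and e
  have pow_lim: "filterlim (\<lambda>j::nat. j ^ m) sequentially sequentially"
    using m by (intro filterlim_at_top_mono[OF filterlim_ident]) (auto intro!: always_eventually self_le_power eventually_sequentiallyI[of 1])
  have "summable (\<lambda>j. avg (grid (j ^ m) S) (\<lambda>e. of_bool (P j e)))"
  proof (rule summable_comparison_test_ev)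
    show "summable (\<lambda>j. (\<bar>C\<bar> + 1) * real j powr - 2)"
      by (intro summable_mult) (simp add: summable_real_powr_iff)
    show "\<forall>\<^sub>F j in sequentially. norm (avg (grid (j ^ m) S) (\<lambda>e. of_bool (P j e))) \<le> (\<bar>C\<bar> + 1) * real j powr - 2"
      using eventually_compose_filterlim[OF up pow_lim] eventually_compose_filterlim[OF lo pow_lim]
        eventually_ge_at_top[of 1]
    proof eventually_elim
      case (elim j)
      have pw: "real (j ^ m) powr - c' \<le> real j powr - 2" if "c \<le> c'" for c'
      proof -
        have "real (j ^ m) powr - c' = real j powr (real m * - c')"
          using elim(3) by (simp add: powr_realpow[symmetric] powr_powr)
        also have "\<dots> \<le> real j powr - 2"
        proof (rule powr_mono)
          have "c * real m \<le> c' * real m" using that by (intro mult_right_mono) auto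
          then show "real m * - c' \<le> - 2" using cm by (simp add: mult.commute)
        qed (use elim(3) in auto)
        finally show ?thesis .
      qed
      have "avg (grid (j ^ m) S) (\<lambda>e. of_bool (P j e)) \<le>
          avg (grid (j ^ m) S) (\<lambda>e. of_bool ((1 + \<epsilon>) * corr_scale k (j ^ m) \<le> ?\<Phi> e (j ^ m)) +
            of_bool (?\<Phi> e (j ^ m) \<le> (1 - \<epsilon>) * corr_scale k (j ^ m)))"
        by (rule avg_mono) (auto simp: P_def)
      also have "\<dots> \<le> C * real (j ^ m) powr - c1 + real (j ^ m) powr - c2"
        unfolding avg_add using elim(1,2) by (rule add_mono)
      also have "\<dots> \<le> \<bar>C\<bar> * real j powr - 2 + 1 * real j powr - 2"
        using pw[of c1] pw[of c2] by (intro add_mono mult_mono) (auto simp: c_def)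
      finally have "avg (grid (j ^ m) S) (\<lambda>e. of_bool (P j e)) \<le> (\<bar>C\<bar> + 1) * real j powr - 2"
        by (simp add: algebra_simps)
      moreover have "0 \<le> avg (grid (j ^ m) S) (\<lambda>e. of_bool (P j e))"
        by (rule avg_nonneg) simp
      ultimately show ?case by simp
    qed
  qed
  from AE_eventually_not[OF this]
  have "AE \<omega> in sign_space S. \<forall>\<^sub>F j in sequentially.
    (1 - \<epsilon>) * corr_scale k (j ^ m) < ?\<Phi> \<omega> (j ^ m) \<and> ?\<Phi> \<omega> (j ^ m) < (1 + \<epsilon>) * corr_scale k (j ^ m)"
  proof eventually_elim
    case (elim \<omega>)
    then show ?case
    proof eventually_elim
      case (elim j)
      have "?\<Phi> (restrict \<omega> (grid (j ^ m) S)) (j ^ m) = ?\<Phi> \<omega> (j ^ m)"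
        using k by (intro cross_corr_cong) auto
      then show ?case using elim unfolding P_def by auto
    qed
  qed
  then show ?thesis using m by blast
qed

section \<open>From the powers j^m to all N\<close>

lemma corr_scale_powers_ratio:
  assumes k: "k \<ge> 2" and m: "m \<ge> 1" and \<epsilon>: "\<epsilon> > 0"
  shows "\<forall>\<^sub>F j in sequentially. corr_scale k ((j + 1) ^ m) \<le> (1 + \<epsilon>) * corr_scale k (j ^ m)"
proof -
  \<comment> \<open>The square of the ratio of consecutive scales; it tends to 1 because m is
    fixed.\<close>
  have "(\<lambda>j::nat. (real (j + 1) / real j) ^ m * (ln (real (j + 1)) / ln (real j))) \<longlonglongrightarrow> 1 ^ m * 1"
    by (intro tendsto_mult tendsto_power) real_asymp+
  then have "\<forall>\<^sub>F j::nat in sequentially. (real (j + 1) / real j) ^ m * (ln (real (j + 1)) / ln (real j)) < (1 + \<epsilon>)\<^sup>2"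
    by (rule order_tendstoD) (use \<epsilon> in \<open>simp add: power2_eq_square algebra_simps add_pos_pos\<close>)
  then show ?thesis
    using eventually_ge_at_top[of 2]
  proof eventually_elim
    case (elim j)
    define A where "A = 2 * real (k - 1) * real m"
    have A: "A \<ge> 0" by (simp add: A_def)
    have sc: "(corr_scale k (i ^ m))\<^sup>2 = A * (real i ^ m * ln (real i))" if "i \<ge> 2" for i
      using that by (subst corr_scale_square) (auto simp: A_def ln_realpow)
    have pos: "0 < real j ^ m * ln (real j)" using elim(2) by simp
    have "real (j + 1) ^ m * ln (real (j + 1)) \<le> (1 + \<epsilon>)\<^sup>2 * (real j ^ m * ln (real j))"
      using elim(1) pos by (simp add: power_divide field_simps)
    then have "A * (real (j + 1) ^ m * ln (real (j + 1))) \<le> A * ((1 + \<epsilon>)\<^sup>2 * (real j ^ m * ln (real j)))"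
      using A by (rule mult_left_mono)
    then have "(corr_scale k ((j + 1) ^ m))\<^sup>2 \<le> ((1 + \<epsilon>) * corr_scale k (j ^ m))\<^sup>2"
      unfolding power_mult_distrib using elim(2) by (simp add: sc algebra_simps)
    then show ?case
      by (rule power2_le_imp_le) (use \<epsilon> elim(2) corr_scale_nonneg[of "j ^ m" k] in simp)
  qed
qed

lemma power_bracket:
  fixes N m :: nat
  assumes m: "m \<ge> 1" and N: "J ^ m \<le> N"
  shows "\<exists>j\<ge>J. j ^ m \<le> N \<and> N < (j + 1) ^ m"
proof -
  define i where "i = (LEAST i. N < i ^ m)"
  have "N + 1 \<le> (N + 1) ^ m" using m by (intro self_le_power) auto
  then have "N < (N + 1) ^ m" by simp
  then have i: "N < i ^ m" unfolding i_def by (rule LeastI)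
  have min: "i' ^ m \<le> N" if "i' < i" for i'
    using not_less_Least[of i' "\<lambda>i. N < i ^ m"] that unfolding i_def by simp
  have "J < i"
  proof (rule ccontr)
    assume "\<not> J < i"
    then have "i ^ m \<le> J ^ m" by (intro power_mono) auto
    then show False using i N by simp
  qed
  then show ?thesis using i min[of "i - 1"] by (intro exI[of _ "i - 1"]) auto
qed

text \<open>Both functions are squeezed between their values at j^m and (j + 1)^m. The constant 3
  comes from (1 + \<epsilon>)^2 <= 1 + 3 \<epsilon>. \<open>start\<close> is there because
  \<open>cross_corr\<close> is monotone only from N = k on.\<close>

lemma eventually_between_powers:
  fixes a \<phi> :: "nat \<Rightarrow> real"
  assumes m: "m \<ge> 1" and \<epsilon>: "0 < \<epsilon>" "\<epsilon> < 1"
    and a: "\<And>N N'. start \<le> N \<Longrightarrow> N \<le> N' \<Longrightarrow> a N \<le> a N'" "\<And>N. start \<le> N \<Longrightarrow> 0 \<le> a N"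
    and \<phi>: "\<And>N N'. start \<le> N \<Longrightarrow> N \<le> N' \<Longrightarrow> \<phi> N \<le> \<phi> N'"
    and ratio: "\<forall>\<^sub>F j in sequentially. a ((j + 1) ^ m) \<le> (1 + \<epsilon>) * a (j ^ m)"
    and bounds: "\<forall>\<^sub>F j in sequentially. (1 - \<epsilon>) * a (j ^ m) < \<phi> (j ^ m) \<and> \<phi> (j ^ m) < (1 + \<epsilon>) * a (j ^ m)"
  shows "\<forall>\<^sub>F N in sequentially. \<bar>\<phi> N - a N\<bar> \<le> 3 * \<epsilon> * a N"
proof -
  obtain J where J: "\<And>j. j \<ge> J \<Longrightarrow> a ((j + 1) ^ m) \<le> (1 + \<epsilon>) * a (j ^ m)"
      "\<And>j. j \<ge> J \<Longrightarrow> (1 - \<epsilon>) * a (j ^ m) < \<phi> (j ^ m) \<and> \<phi> (j ^ m) < (1 + \<epsilon>) * a (j ^ m)"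
    using eventually_conj[OF ratio bounds] unfolding eventually_sequentially by blast
  show ?thesis
    using eventually_ge_at_top[of "(max J (max start 1)) ^ m"]
  proof eventually_elim
    case (elim N)
    obtain j where j: "max J (max start 1) \<le> j" "j ^ m \<le> N" "N < (j + 1) ^ m"
      using power_bracket[OF m elim] by blast
    \<comment> \<open>Ensures that j^m, too, lies beyond \<open>start\<close>.\<close>
    have "j \<le> j ^ m" using m j(1) by (intro self_le_power) auto
    then have n0: "start \<le> j ^ m" "start \<le> N" using j by auto
    have mono: "a (j ^ m) \<le> a N" "a N \<le> a ((j + 1) ^ m)" "\<phi> (j ^ m) \<le> \<phi> N" "\<phi> N \<le> \<phi> ((j + 1) ^ m)"
      using a(1) \<phi> n0 j by auto
    have J1: "a ((j + 1) ^ m) \<le> (1 + \<epsilon>) * a (j ^ m)" using J(1) j by auto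
    have lo: "(1 - \<epsilon>) * a (j ^ m) < \<phi> (j ^ m)" using J(2)[of j] j by auto
    have up: "\<phi> ((j + 1) ^ m) < (1 + \<epsilon>) * a ((j + 1) ^ m)" using J(2)[of "j + 1"] j by auto
    have aN: "0 \<le> a N" "0 \<le> a (j ^ m)" using a(2) n0 by auto
    have "(1 + \<epsilon>) * a ((j + 1) ^ m) \<le> (1 + \<epsilon>) * ((1 + \<epsilon>) * a N)"
    proof -
      have "(1 + \<epsilon>) * a (j ^ m) \<le> (1 + \<epsilon>) * a N" using mono(1) \<epsilon> by (intro mult_left_mono) auto
      then have "a ((j + 1) ^ m) \<le> (1 + \<epsilon>) * a N" using J1 by linarith
      then show ?thesis using \<epsilon> by (intro mult_left_mono) auto
    qed
    also have "\<dots> \<le> (1 + 3 * \<epsilon>) * a N"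
    proof -
      have "(1 + \<epsilon>) * (1 + \<epsilon>) \<le> 1 + 3 * \<epsilon>" using \<epsilon> mult_left_le[of \<epsilon> \<epsilon>] by (simp add: algebra_simps)
      then show ?thesis using aN(1) by (simp only: mult.assoc[symmetric] mult_right_mono)
    qed
    finally have U: "\<phi> N \<le> (1 + 3 * \<epsilon>) * a N" using mono up by linarith
    have "(1 - \<epsilon>) * a N \<le> (1 - \<epsilon>) * ((1 + \<epsilon>) * a (j ^ m))"
      using mono J1 \<epsilon> by (intro mult_left_mono) auto
    also have "\<dots> = (1 - \<epsilon>) * a (j ^ m) + \<epsilon> * ((1 - \<epsilon>) * a (j ^ m))" by (simp add: algebra_simps)
    also have "\<dots> \<le> \<phi> N + \<epsilon> * a N"
    proof (rule add_mono)
      show "(1 - \<epsilon>) * a (j ^ m) \<le> \<phi> N" using lo mono by linarith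
      have "(1 - \<epsilon>) * a (j ^ m) \<le> 1 * a N" using \<epsilon> aN mono by (intro mult_mono) auto
      then show "\<epsilon> * ((1 - \<epsilon>) * a (j ^ m)) \<le> \<epsilon> * a N" using \<epsilon> by simp
    qed
    finally have "(1 - 2 * \<epsilon>) * a N \<le> \<phi> N" by (simp add: algebra_simps)
    moreover have "(1 - 3 * \<epsilon>) * a N \<le> (1 - 2 * \<epsilon>) * a N" using aN \<epsilon> by (intro mult_right_mono) auto
    ultimately show ?case using U by (simp add: abs_le_iff algebra_simps)
  qed
qed

theorem theorem4:
  fixes S k :: nat
  assumes "S \<ge> 1" and "k \<ge> 2"
  shows "AE \<omega> in sign_space S.
           (\<lambda>N. cross_corr k (\<lambda>n s. \<omega> (n, s)) N S
                 / sqrt (2 * real N * ln (real (N choose (k - 1)))))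
           \<longlonglongrightarrow> 1"
proof -
  let ?\<Phi> = "\<lambda>\<omega> N. cross_corr k (\<lambda>n s. \<omega> (n, s)) N S"
  \<comment> \<open>The null set depends on \<epsilon>, so only countably many values are used; q +
    2 keeps \<epsilon> strictly below 1.\<close>
  have "AE \<omega> in sign_space S. \<forall>q::nat. \<forall>\<^sub>F N in sequentially.
      \<bar>?\<Phi> \<omega> N - corr_scale k N\<bar> \<le> 3 * (1 / real (q + 2)) * corr_scale k N"
  proof (subst AE_all_countable, intro allI)
    fix q :: nat
    define \<epsilon> where "\<epsilon> = 1 / real (q + 2)"
    have \<epsilon>: "0 < \<epsilon>" "\<epsilon> < 1" by (auto simp: \<epsilon>_def)
    obtain m where m: "m \<ge> 1" and AE: "AE \<omega> in sign_space S. \<forall>\<^sub>F j in sequentially.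
        (1 - \<epsilon>) * corr_scale k (j ^ m) < ?\<Phi> \<omega> (j ^ m) \<and> ?\<Phi> \<omega> (j ^ m) < (1 + \<epsilon>) * corr_scale k (j ^ m)"
      using AE_cross_corr_powers[OF assms \<epsilon>] by blast
    from AE show "AE \<omega> in sign_space S. \<forall>\<^sub>F N in sequentially.
        \<bar>?\<Phi> \<omega> N - corr_scale k N\<bar> \<le> 3 * (1 / real (q + 2)) * corr_scale k N"
    proof eventually_elim
      case (elim \<omega>)
      show ?case
        unfolding \<epsilon>_def[symmetric]
      proof (rule eventually_between_powers[OF m \<epsilon>, where start = k])
        show "?\<Phi> \<omega> N \<le> ?\<Phi> \<omega> N'" if "k \<le> N" "N \<le> N'" for N N'
          using assms that by (intro cross_corr_mono) auto
        show "corr_scale k N \<le> corr_scale k N'" if "k \<le> N" "N \<le> N'" for N N'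
          using assms that by (intro corr_scale_mono) auto
        show "0 \<le> corr_scale k N" if "k \<le> N" for N
          using assms that by (intro corr_scale_nonneg) auto
      qed (use elim corr_scale_powers_ratio[OF assms(2) m \<epsilon>(1)] in auto)
    qed
  qed
  then show ?thesis
  proof eventually_elim
    case (elim \<omega>)
    have "(\<lambda>N. ?\<Phi> \<omega> N / corr_scale k N) \<longlonglongrightarrow> 1"
    proof (rule tendstoI)
      fix r :: real
      assume "0 < r"
      then obtain q :: nat where q: "3 / r < real q" using reals_Archimedean2 by blast
      have "3 / r < real (q + 2)" using q by simp
      then have qr: "3 * (1 / real (q + 2)) < r" using \<open>0 < r\<close> by (simp add: field_simps)
      show "\<forall>\<^sub>F N in sequentially. dist (?\<Phi> \<omega> N / corr_scale k N) 1 < r"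
        using elim[rule_format, of q] eventually_ge_at_top[of 2]
      proof eventually_elim
        case (elim N)
        have sc: "0 < corr_scale k N" by (rule corr_scale_pos[OF assms(2) elim(2)])
        have "?\<Phi> \<omega> N / corr_scale k N - 1 = (?\<Phi> \<omega> N - corr_scale k N) / corr_scale k N"
          using sc by (simp add: diff_divide_distrib)
        then have "dist (?\<Phi> \<omega> N / corr_scale k N) 1 = \<bar>?\<Phi> \<omega> N - corr_scale k N\<bar> / corr_scale k N"
          using sc by (simp add: dist_real_def)
        also have "\<dots> \<le> 3 * (1 / real (q + 2))"
          using elim(1) sc by (simp add: pos_divide_le_eq)
        finally show ?case using qr by simp
      qed
    qed
    from tendsto_mult[OF this corr_scale_over_norm_tendsto[OF assms(2)]]
    have "(\<lambda>N. ?\<Phi> \<omega> N / corr_scale k N * (corr_scale k N / sqrt (2 * real N * ln (real (N choose (k - 1)))))) \<longlonglongrightarrow> 1"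
      by simp
    then show ?case
    proof (rule Lim_transform_eventually)
      show "\<forall>\<^sub>F N in sequentially. ?\<Phi> \<omega> N / corr_scale k N * (corr_scale k N / sqrt (2 * real N * ln (real (N choose (k - 1)))))
          = ?\<Phi> \<omega> N / sqrt (2 * real N * ln (real (N choose (k - 1))))"
        using eventually_ge_at_top[of 2]
        by eventually_elim (use corr_scale_pos[OF assms(2)] in \<open>auto simp: less_imp_neq[symmetric]\<close>)
    qed
  qed
qed

end
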